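(* Work in ZF set theory (without assuming the Axiom of Choice). Let $X$ be a set such that $\omega \preceq X$. Then there is no injection from $\mathcal{P}X$ into $\bigcup_{n\in\omega} X^n$, i.e. $\neg\,(\mathcal{P}X \preceq \bigcup_{n\in\omega} X^n)$.
   Context: For sets $a,b$: $a \preceq b$ means there is an injection from $a$ into $b$. $\mathcal{P}X$ is the power set of $X$, and $X^n$ is the set of functions from the natural number $n=\{0,\dots,n-1\}$ to $X$, so $\bigcup_{n\in\omega} X^n$ is the set of finite sequences of elements of $X$. *)

theory Defs
  imports Main
begin

text \<open>
  The logic HOL has a choice operator, so a claim about HOL sets is not a claim of ZF.
  The ambient theory ZF is therefore rendered by quantifying over all first-order structures
  (universe: a type; membership: an arbitrary binary relation on it) that satisfy the axioms of ZF.
  Separation and Replacement range over first-order formulas only: if they ranged over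
  arbitrary HOL predicates, every structure would inherit the axiom of choice from HOL.
  By the completeness and the Loewenheim-Skolem theorem, validity in all
  such structures is provability in ZF.
\<close>

datatype fm = Mem nat nat | Equal nat nat | Neg fm | And fm fm | All nat fm

primrec sat :: "('a \<Rightarrow> 'a \<Rightarrow> bool) \<Rightarrow> (nat \<Rightarrow> 'a) \<Rightarrow> fm \<Rightarrow> bool" where
  "sat E v (Mem i j) \<longleftrightarrow> E (v i) (v j)"
| "sat E v (Equal i j) \<longleftrightarrow> v i = v j"
| "sat E v (Neg p) \<longleftrightarrow> \<not> sat E v p"
| "sat E v (And p q) \<longleftrightarrow> sat E v p \<and> sat E v q"
| "sat E v (All i p) \<longleftrightarrow> (\<forall>x. sat E (v(i := x)) p)"

definition "Ex_fm i p = Neg (All i (Neg p))"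
definition "Imp_fm p q = Neg (And p (Neg q))"
definition "Iff_fm p q = And (Imp_fm p q) (Imp_fm q p)"
definition "Or_fm p q = Neg (And (Neg p) (Neg q))"

lemma sat_derived [simp]:
  "sat E v (Ex_fm i p) \<longleftrightarrow> (\<exists>x. sat E (v(i := x)) p)"
  "sat E v (Imp_fm p q) \<longleftrightarrow> (sat E v p \<longrightarrow> sat E v q)"
  "sat E v (Iff_fm p q) \<longleftrightarrow> (sat E v p \<longleftrightarrow> sat E v q)"
  "sat E v (Or_fm p q) \<longleftrightarrow> sat E v p \<or> sat E v q"
  by (auto simp: Ex_fm_def Imp_fm_def Iff_fm_def Or_fm_def)

locale set_structure =
  fixes mem :: "'a \<Rightarrow> 'a \<Rightarrow> bool"  (infix "\<in>\<^sub>M" 50)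
begin

text \<open>
  \<open>coll P\<close> is the set of all \<open>x\<close> with \<open>P x\<close>; it is unspecified if there is no such set.
  Lemmas below show that in models of ZF each use of it here does denote.
\<close>

definition coll :: "('a \<Rightarrow> bool) \<Rightarrow> 'a" where
  "coll P = (THE A. \<forall>x. x \<in>\<^sub>M A \<longleftrightarrow> P x)"

definition subset_of :: "'a \<Rightarrow> 'a \<Rightarrow> bool" where
  "subset_of A B \<longleftrightarrow> (\<forall>x. x \<in>\<^sub>M A \<longrightarrow> x \<in>\<^sub>M B)"

definition pow :: "'a \<Rightarrow> 'a" where
  "pow A = coll (\<lambda>x. subset_of x A)"

definition upair :: "'a \<Rightarrow> 'a \<Rightarrow> 'a" where
  "upair a b = coll (\<lambda>x. x = a \<or> x = b)"

definition pair :: "'a \<Rightarrow> 'a \<Rightarrow> 'a" where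
  "pair a b = upair (upair a a) (upair a b)"

definition is_inductive :: "'a \<Rightarrow> bool" where
  "is_inductive I \<longleftrightarrow>
     (\<exists>e. e \<in>\<^sub>M I \<and> (\<forall>x. \<not> x \<in>\<^sub>M e)) \<and>
     (\<forall>n. n \<in>\<^sub>M I \<longrightarrow> (\<exists>s. s \<in>\<^sub>M I \<and> (\<forall>x. x \<in>\<^sub>M s \<longleftrightarrow> x \<in>\<^sub>M n \<or> x = n)))"

text \<open>The least inductive set, so its elements are the von Neumann naturals \<open>n = {0,\<dots>,n-1}\<close>.\<close>

definition omega :: 'a where
  "omega = coll (\<lambda>n. \<forall>I. is_inductive I \<longrightarrow> n \<in>\<^sub>M I)"

definition maps :: "'a \<Rightarrow> 'a \<Rightarrow> 'a \<Rightarrow> bool" where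
  "maps f A B \<longleftrightarrow>
     (\<forall>p. p \<in>\<^sub>M f \<longrightarrow> (\<exists>x y. x \<in>\<^sub>M A \<and> y \<in>\<^sub>M B \<and> p = pair x y)) \<and>
     (\<forall>x. x \<in>\<^sub>M A \<longrightarrow> (\<exists>!y. pair x y \<in>\<^sub>M f))"

definition injection :: "'a \<Rightarrow> 'a \<Rightarrow> 'a \<Rightarrow> bool" where
  "injection f A B \<longleftrightarrow>
     maps f A B \<and> (\<forall>x x' y. pair x y \<in>\<^sub>M f \<and> pair x' y \<in>\<^sub>M f \<longrightarrow> x = x')"

definition lepoll :: "'a \<Rightarrow> 'a \<Rightarrow> bool"  (infix "\<lesssim>\<^sub>M" 50) where
  "A \<lesssim>\<^sub>M B \<longleftrightarrow> (\<exists>f. injection f A B)"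

definition funs :: "'a \<Rightarrow> 'a \<Rightarrow> 'a" where
  "funs A B = coll (\<lambda>f. maps f A B)"

definition finseqs :: "'a \<Rightarrow> 'a" where
  "finseqs X = coll (\<lambda>s. \<exists>n. n \<in>\<^sub>M omega \<and> s \<in>\<^sub>M funs n X)"

end

text \<open>
  In the two schemas the valuation \<open>v\<close> supplies the parameters; the variables 0 and 1 of the
  formula are the ones bound by the axiom.
\<close>

locale ZF = set_structure +
  assumes extensionality: "(\<forall>x. x \<in>\<^sub>M A \<longleftrightarrow> x \<in>\<^sub>M B) \<Longrightarrow> A = B"
    and foundation: "x \<in>\<^sub>M A \<Longrightarrow> \<exists>m. m \<in>\<^sub>M A \<and> (\<forall>z. z \<in>\<^sub>M m \<longrightarrow> \<not> z \<in>\<^sub>M A)"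
    and pairing: "\<exists>C. \<forall>x. x \<in>\<^sub>M C \<longleftrightarrow> x = a \<or> x = b"
    and union: "\<exists>U. \<forall>x. x \<in>\<^sub>M U \<longleftrightarrow> (\<exists>B. B \<in>\<^sub>M A \<and> x \<in>\<^sub>M B)"
    and powerset: "\<exists>P. \<forall>x. x \<in>\<^sub>M P \<longleftrightarrow> subset_of x A"
    and infinity: "\<exists>I. is_inductive I"
    and separation: "\<exists>B. \<forall>x. x \<in>\<^sub>M B \<longleftrightarrow> x \<in>\<^sub>M A \<and> sat (\<in>\<^sub>M) (v(0 := x)) \<phi>"
    and replacement:
      "(\<forall>x. x \<in>\<^sub>M A \<longrightarrow> (\<exists>!y. sat (\<in>\<^sub>M) (v(0 := x, 1 := y)) \<phi>)) \<Longrightarrow>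
        \<exists>B. \<forall>y. y \<in>\<^sub>M B \<longleftrightarrow> (\<exists>x. x \<in>\<^sub>M A \<and> sat (\<in>\<^sub>M) (v(0 := x, 1 := y)) \<phi>)"
begin

lemma coll_iff:
  assumes "\<exists>A. \<forall>x. x \<in>\<^sub>M A \<longleftrightarrow> P x"
  shows "x \<in>\<^sub>M coll P \<longleftrightarrow> P x"
proof -
  obtain A where A: "\<forall>x. x \<in>\<^sub>M A \<longleftrightarrow> P x" using assms by blast
  have "coll P = A" unfolding coll_def
    by (rule the_equality) (use A in \<open>auto intro: extensionality\<close>)
  then show ?thesis using A by simp
qed

lemma mem_pow_iff: "x \<in>\<^sub>M pow A \<longleftrightarrow> subset_of x A"
  unfolding pow_def by (rule coll_iff[OF powerset])

lemma mem_upair_iff: "x \<in>\<^sub>M upair a b \<longleftrightarrow> x = a \<or> x = b"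
  unfolding upair_def by (rule coll_iff[OF pairing])

lemma eq_upair_iff: "p = upair a b \<longleftrightarrow> (\<forall>x. x \<in>\<^sub>M p \<longleftrightarrow> x = a \<or> x = b)"
  using mem_upair_iff extensionality by metis

lemma pair_inject: "pair a b = pair c d \<longleftrightarrow> a = c \<and> b = d"
proof -
  have *: "upair u w = upair x y \<longleftrightarrow> u = x \<and> w = y \<or> u = y \<and> w = x" for u w x y
  proof
    assume "upair u w = upair x y"
    then have "z = u \<or> z = w \<longleftrightarrow> z = x \<or> z = y" for z
      by (metis mem_upair_iff)
    then show "u = x \<and> w = y \<or> u = y \<and> w = x" by metis
  next
    assume "u = x \<and> w = y \<or> u = y \<and> w = x"
    then show "upair u w = upair x y" by (auto simp: eq_upair_iff mem_upair_iff)
  qed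
  show ?thesis unfolding pair_def * by blast
qed

definition upair_fm :: "nat \<Rightarrow> nat \<Rightarrow> nat \<Rightarrow> fm" where
  "upair_fm p a b = All 22 (Iff_fm (Mem 22 p) (Or_fm (Equal 22 a) (Equal 22 b)))"

lemma sat_upair_fm:
  assumes "p < 22" "a < 22" "b < 22"
  shows "sat (\<in>\<^sub>M) v (upair_fm p a b) \<longleftrightarrow> v p = upair (v a) (v b)"
  using assms by (simp add: upair_fm_def eq_upair_iff)

text \<open>\<open>pair_fm p a b\<close> uses the variables 20, 21, 22 as auxiliary bound variables.\<close>

definition pair_fm :: "nat \<Rightarrow> nat \<Rightarrow> nat \<Rightarrow> fm" where
  "pair_fm p a b =
     Ex_fm 20 (Ex_fm 21 (And (upair_fm 20 a a) (And (upair_fm 21 a b) (upair_fm p 20 21))))"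

lemma sat_pair_fm:
  assumes "p < 20" "a < 20" "b < 20"
  shows "sat (\<in>\<^sub>M) v (pair_fm p a b) \<longleftrightarrow> v p = pair (v a) (v b)"
  using assms by (simp add: pair_fm_def sat_upair_fm pair_def)

definition maps_fm :: fm where
  "maps_fm = And
     (All 4 (Imp_fm (Mem 4 0)
        (Ex_fm 5 (Ex_fm 6 (And (Mem 5 1) (And (Mem 6 2) (pair_fm 4 5 6)))))))
     (All 5 (Imp_fm (Mem 5 1)
        (Ex_fm 6 (All 7 (Iff_fm (Ex_fm 4 (And (Mem 4 0) (pair_fm 4 5 7))) (Equal 7 6))))))"

lemma sat_maps_fm: "sat (\<in>\<^sub>M) v maps_fm \<longleftrightarrow> maps (v 0) (v 1) (v 2)"
proof -
  have ex1: "(\<exists>!y. Q y) \<longleftrightarrow> (\<exists>y. \<forall>z. Q z \<longleftrightarrow> z = y)" for Q :: "'a \<Rightarrow> bool" by auto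
  show ?thesis unfolding maps_fm_def maps_def ex1 by (simp add: sat_pair_fm)
qed

lemma ex_bin_union: "\<exists>U. \<forall>x. x \<in>\<^sub>M U \<longleftrightarrow> x \<in>\<^sub>M A \<or> x \<in>\<^sub>M B"
  using union[of "upair A B"] by (metis mem_upair_iff)

lemma ex_funs_bound: "\<exists>P. \<forall>n f. subset_of n A \<longrightarrow> maps f n B \<longrightarrow> f \<in>\<^sub>M P"
proof -
  obtain U where U: "\<forall>x. x \<in>\<^sub>M U \<longleftrightarrow> x \<in>\<^sub>M A \<or> x \<in>\<^sub>M B" using ex_bin_union by blast
  have "f \<in>\<^sub>M pow (pow (pow U))" if "subset_of n A" "maps f n B" for n f
  proof -
    have "p \<in>\<^sub>M pow (pow U)" if "p \<in>\<^sub>M f" for p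
    proof -
      obtain x y where "x \<in>\<^sub>M n" "y \<in>\<^sub>M B" and p: "p = pair x y"
        using \<open>p \<in>\<^sub>M f\<close> \<open>maps f n B\<close> unfolding maps_def by blast
      then have "x \<in>\<^sub>M U" "y \<in>\<^sub>M U"
        using \<open>subset_of n A\<close> U by (auto simp: subset_of_def)
      then show ?thesis
        by (auto simp: p pair_def mem_pow_iff subset_of_def mem_upair_iff)
    qed
    then show ?thesis by (simp add: mem_pow_iff[of f] subset_of_def[of f])
  qed
  then show ?thesis by blast
qed

lemma mem_funs_iff: "f \<in>\<^sub>M funs A B \<longleftrightarrow> maps f A B"
proof -
  obtain P where P: "\<And>f. maps f A B \<Longrightarrow> f \<in>\<^sub>M P"
    using ex_funs_bound[of A B] by (auto simp: subset_of_def)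
  obtain F where "\<forall>f. f \<in>\<^sub>M F \<longleftrightarrow> f \<in>\<^sub>M P \<and> maps f A B"
    using separation[of P "(\<lambda>_. A)(2 := B)" maps_fm] by (auto simp: sat_maps_fm)
  then show ?thesis unfolding funs_def using P by (intro coll_iff) blast
qed

lemma mem_omega_iff: "n \<in>\<^sub>M omega \<longleftrightarrow> (\<forall>I. is_inductive I \<longrightarrow> n \<in>\<^sub>M I)"
proof -
  define ind where "ind = And
     (Ex_fm 2 (And (Mem 2 1) (All 3 (Neg (Mem 3 2)))))
     (All 2 (Imp_fm (Mem 2 1) (Ex_fm 3 (And (Mem 3 1)
        (All 4 (Iff_fm (Mem 4 3) (Or_fm (Mem 4 2) (Equal 4 2))))))))"
  have ind: "sat (\<in>\<^sub>M) v ind \<longleftrightarrow> is_inductive (v 1)" for v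
    unfolding ind_def is_inductive_def by simp
  obtain I where I: "is_inductive I" using infinity by blast
  obtain W where "\<forall>n. n \<in>\<^sub>M W \<longleftrightarrow> n \<in>\<^sub>M I \<and> (\<forall>J. is_inductive J \<longrightarrow> n \<in>\<^sub>M J)"
    using separation[of I "\<lambda>_. I" "All 1 (Imp_fm ind (Mem 0 1))"] by (auto simp: ind)
  then show ?thesis unfolding omega_def using I by (intro coll_iff) blast
qed

lemma mem_finseqs_iff: "s \<in>\<^sub>M finseqs X \<longleftrightarrow> (\<exists>n. n \<in>\<^sub>M omega \<and> s \<in>\<^sub>M funs n X)"
proof -
  obtain A where A: "\<forall>x. x \<in>\<^sub>M A \<longleftrightarrow> (\<exists>n. n \<in>\<^sub>M omega \<and> x \<in>\<^sub>M n)"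
    using union by blast
  obtain P where P: "\<And>n f. n \<in>\<^sub>M omega \<Longrightarrow> maps f n X \<Longrightarrow> f \<in>\<^sub>M P"
    using ex_funs_bound[of A X] A unfolding subset_of_def by blast
  obtain F where "\<forall>s. s \<in>\<^sub>M F \<longleftrightarrow> s \<in>\<^sub>M P \<and> (\<exists>n. n \<in>\<^sub>M omega \<and> maps s n X)"
    using separation[of P "(\<lambda>_. X)(3 := omega)" "Ex_fm 1 (And (Mem 1 3) maps_fm)"]
    by (auto simp: sat_maps_fm)
  then show ?thesis unfolding finseqs_def mem_funs_iff using P by (intro coll_iff) blast
qed

end

end

theory Submission
  imports Defs
begin

text \<open>
  Suppose \<open>F\<close> injects \<open>\<P>X\<close> into the finite sequences over \<open>X\<close>. Given a subset \<open>S\<close> of \<open>X\<close> and a coding of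
  the finite sequences over \<open>S\<close> by elements of \<open>S\<close>, let \<open>D\<close> be the set of codes \<open>y\<close> of sequences \<open>F A\<close> with
  \<open>y \<notin> A\<close>. By Cantor's argument \<open>F D\<close> is not a sequence over \<open>S\<close>, so its first entry outside \<open>S\<close> is
  a canonical new element of \<open>X\<close>. Starting with a copy of \<open>\<omega>\<close>, one can thus extend \<open>S\<close> transfinitely, which is
  absurd, provided that the codings are also extended canonically. To this end \<open>S\<close> is well-ordered and contains a
  base \<open>B\<close> with a pairing \<open>B \<times> B \<rightarrow> B\<close>, and each element of \<open>S - B\<close> is labelled by an
  element of \<open>B\<close>. While labels are available, a new element of \<open>X\<close> is added and gets the least free
  one; this leaves \<open>S\<close> injectable into \<open>B + B\<close>, hence into \<open>B\<close>. When the labels are exhausted,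
  \<open>S - B\<close> is a copy of \<open>B\<close>, so the pairing extends to \<open>S\<close> with new values in \<open>S - B\<close>, and
  \<open>S\<close> becomes the base. A Bourbaki-Witt argument, which needs no ordinals and no choice, yields a fixed point
  of this extension step, a contradiction.
\<close>

section \<open>Definability with parameters\<close>

fun rename :: "(nat \<Rightarrow> nat) \<Rightarrow> fm \<Rightarrow> fm" where
  "rename f (Mem i j) = Mem (f i) (f j)"
| "rename f (Equal i j) = Equal (f i) (f j)"
| "rename f (Neg p) = Neg (rename f p)"
| "rename f (And p q) = And (rename f p) (rename f q)"
| "rename f (All i p) = All (f i) (rename f p)"

text \<open>Injectivity keeps the renamed bound variable apart from the images of all other
  variables, so no capture occurs.\<close>

lemma sat_rename: "inj f \<Longrightarrow> sat E v (rename f p) \<longleftrightarrow> sat E (v \<circ> f) p"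
proof (induction p arbitrary: v)
  case (All i p)
  have "(v(f i := x)) \<circ> f = (v \<circ> f)(i := x)" for x
    using All.prems by (auto simp: fun_eq_iff inj_eq)
  then show ?case by (simp only: rename.simps sat.simps All.IH[OF All.prems])
qed auto

text \<open>The parameters occupy the first variables and \<open>v\<close> follows behind them. A
  formula together with a finite list of sets thus represents a predicate on valuations.\<close>

definition shift_env :: "'a list \<Rightarrow> (nat \<Rightarrow> 'a) \<Rightarrow> nat \<Rightarrow> 'a" where
  "shift_env ws v i = (if i < length ws then ws ! i else v (i - length ws))"

context set_structure
begin

text \<open>Working with predicates on valuations instead of formulas allows closure rules to be
  applied directly. A quantifier binds variable 0 and shifts the others, as with de Bruijn indices;
  \<open>eq_const\<close> admits arbitrary sets as parameters.\<close>

inductive definable :: "((nat \<Rightarrow> 'a) \<Rightarrow> bool) \<Rightarrow> bool" where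
  mem: "definable (\<lambda>v. v i \<in>\<^sub>M v j)"
| eq: "definable (\<lambda>v. v i = v j)"
| eq_const: "definable (\<lambda>v. v i = c)"
| neg: "definable P \<Longrightarrow> definable (\<lambda>v. \<not> P v)"
| conj: "definable P \<Longrightarrow> definable Q \<Longrightarrow> definable (\<lambda>v. P v \<and> Q v)"
| all: "definable P \<Longrightarrow> definable (\<lambda>v. \<forall>x. P (case_nat x v))"

text \<open>This ties the semantic notion to the first-order schemas: the constants used in a
  derivation are collected in \<open>ws\<close>.\<close>

lemma definable_sat:
  assumes "definable P"
  shows "\<exists>\<phi> ws. \<forall>v. P v \<longleftrightarrow> sat (\<in>\<^sub>M) (shift_env ws v) \<phi>"
  using assms
proof induction
  case (mem i j)
  show ?case by (rule exI[of _ "Mem i j"], rule exI[of _ "[]"]) (simp add: shift_env_def)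
next
  case (eq i j)
  show ?case by (rule exI[of _ "Equal i j"], rule exI[of _ "[]"]) (simp add: shift_env_def)
next
  case (eq_const i c)
  show ?case
    by (rule exI[of _ "Equal (Suc i) 0"], rule exI[of _ "[c]"]) (simp add: shift_env_def)
next
  case (neg P)
  then obtain \<phi> ws where "\<forall>v. P v \<longleftrightarrow> sat (\<in>\<^sub>M) (shift_env ws v) \<phi>" by blast
  then show ?case by (intro exI[of _ "Neg \<phi>"] exI[of _ ws]) simp
next
  case (conj P Q)
  then obtain \<phi> ws \<psi> us where
    P: "\<And>v. P v \<longleftrightarrow> sat (\<in>\<^sub>M) (shift_env ws v) \<phi>" and
    Q: "\<And>v. Q v \<longleftrightarrow> sat (\<in>\<^sub>M) (shift_env us v) \<psi>" by blast
  \<comment> \<open>The two parameter lists are concatenated: \<open>f\<close> fixes the indices of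
    \<open>ws\<close> and moves the proper variables past \<open>us\<close>, while \<open>g\<close>
    moves everything past \<open>ws\<close>.\<close>
  define f where "f i = (if i < length ws then i else i + length us)" for i
  define g where "g i = i + length ws" for i
  have "inj f" by (auto simp: inj_def f_def)
  moreover have "inj g" by (auto simp: inj_def g_def)
  moreover have "shift_env (ws @ us) v \<circ> f = shift_env ws v" for v
    by (auto simp: fun_eq_iff shift_env_def f_def nth_append)
  moreover have "shift_env (ws @ us) v \<circ> g = shift_env us v" for v
    by (auto simp: fun_eq_iff shift_env_def g_def nth_append)
  ultimately show ?case
    by (intro exI[of _ "And (rename f \<phi>) (rename g \<psi>)"] exI[of _ "ws @ us"])
      (simp add: sat_rename P Q)
next
  case (all P)
  then obtain \<phi> ws where P: "\<And>v. P v \<longleftrightarrow> sat (\<in>\<^sub>M) (shift_env ws v) \<phi>" by blast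
  \<comment> \<open>The dummy entry \<open>undefined\<close> reserves the slot just behind the
    parameters, into which the quantifier writes its value.\<close>
  have "(shift_env (ws @ [undefined]) v)(length ws := x) = shift_env ws (case_nat x v)" for v x
  proof
    fix i
    consider "i < length ws" | "i = length ws" | k where "i = Suc (length ws + k)"
      by (metis less_imp_Suc_add linorder_neqE_nat)
    then show "((shift_env (ws @ [undefined]) v)(length ws := x)) i
        = shift_env ws (case_nat x v) i"
      by cases (auto simp: shift_env_def nth_append)
  qed
  then show ?case
    by (intro exI[of _ "All (length ws) \<phi>"] exI[of _ "ws @ [undefined]"]) (simp add: P)
qed

text \<open>Needed to substitute terms for several arguments. Under a quantifier, \<open>g\<close>
  is lifted so as to fix variable 0.\<close>

lemma definable_reindex: "definable P \<Longrightarrow> definable (\<lambda>v. P (\<lambda>i. v (g i)))"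
proof (induction arbitrary: g rule: definable.induct)
  case (mem i j)
  show ?case by (rule definable.mem)
next
  case (eq i j)
  show ?case by (rule definable.eq)
next
  case (eq_const i c)
  show ?case by (rule definable.eq_const)
next
  case (neg P)
  show ?case by (rule definable.neg[OF neg.IH])
next
  case (conj P Q)
  show ?case by (rule definable.conj[OF conj.IH])
next
  case (all P)
  have *: "(\<lambda>i. case_nat x v (case_nat 0 (\<lambda>i. Suc (g i)) i)) = case_nat x (\<lambda>i. v (g i))"
    for x and v :: "nat \<Rightarrow> 'a"
    by (auto simp: fun_eq_iff split: nat.splits)
  show ?case
    using definable.all[OF all.IH[of "case_nat 0 (\<lambda>i. Suc (g i))"]] by (simp only: *)
qed

text \<open>The language has no function symbols, so a term is treated through its graph, with the
  value in variable 0.\<close>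

definition definable_term :: "((nat \<Rightarrow> 'a) \<Rightarrow> 'a) \<Rightarrow> bool" where
  "definable_term t \<longleftrightarrow> definable (\<lambda>v. v 0 = t (\<lambda>i. v (Suc i)))"

text \<open>
  Predicates are written with bound variables of HOL; the rules below translate them to de Bruijn
  indices, so that \<open>intro df\<close> proves definability.
\<close>

named_theorems df

lemma definable_all [df]:
  "definable (\<lambda>v. P (v 0) (\<lambda>i. v (Suc i))) \<Longrightarrow> definable (\<lambda>v. \<forall>x. P x v)"
  by (drule definable.all) simp

lemma definable_neg [df]: "definable P \<Longrightarrow> definable (\<lambda>v. \<not> P v)"
  by (rule definable.neg)

lemma definable_conj [df]: "definable P \<Longrightarrow> definable Q \<Longrightarrow> definable (\<lambda>v. P v \<and> Q v)"
  by (rule definable.conj)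

lemma definable_disj [df]:
  assumes "definable P" "definable Q"
  shows "definable (\<lambda>v. P v \<or> Q v)"
proof -
  have "definable (\<lambda>v. \<not> (\<not> P v \<and> \<not> Q v))"
    by (rule definable_neg definable_conj assms)+
  then show ?thesis by simp
qed

lemma definable_imp [df]:
  assumes "definable P" "definable Q"
  shows "definable (\<lambda>v. P v \<longrightarrow> Q v)"
proof -
  have "definable (\<lambda>v. \<not> P v \<or> Q v)"
    by (rule definable_neg definable_disj assms)+
  then show ?thesis by simp
qed

lemma definable_iff [df]:
  assumes "definable P" "definable Q"
  shows "definable (\<lambda>v. P v \<longleftrightarrow> Q v)"
  unfolding iff_conv_conj_imp by (rule definable_conj definable_imp assms)+

lemma definable_ex [df]:
  assumes "definable (\<lambda>v. P (v 0) (\<lambda>i. v (Suc i)))"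
  shows "definable (\<lambda>v. \<exists>x. P x v)"
proof -
  have "definable (\<lambda>v. \<not> (\<forall>x. \<not> P x v))"
    by (rule definable_neg definable_all assms)+
  then show ?thesis by simp
qed

lemma definable_term_var [df]: "definable_term (\<lambda>v. v n)"
  unfolding definable_term_def by (rule definable.eq)

lemma definable_term_const [df]: "definable_term (\<lambda>v. c)"
  unfolding definable_term_def by (rule definable.eq_const)

lemma definable_term_shift:
  assumes "definable_term t"
  shows "definable_term (\<lambda>v. t (\<lambda>i. v (Suc i)))"
  using definable_reindex[OF assms[unfolded definable_term_def], of "case_nat 0 (\<lambda>i. Suc (Suc i))"]
  unfolding definable_term_def by simp

text \<open>A term is eliminated by naming its value with an existential quantifier.\<close>

lemma definable_subst:
  assumes "definable_term t" "definable (\<lambda>v. P (v 0) (\<lambda>i. v (Suc i)))"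
  shows "definable (\<lambda>v. P (t v) v)"
proof -
  have "definable (\<lambda>v. \<exists>y. y = t v \<and> P y v)"
    by (rule definable_ex, rule definable_conj)
      (rule assms(1)[unfolded definable_term_def] assms(2))+
  then show ?thesis by simp
qed

lemma definable_comp1:
  assumes "definable (\<lambda>v. P (v 0))" "definable_term t"
  shows "definable (\<lambda>v. P (t v))"
  by (rule definable_subst[OF assms(2)]) (rule assms(1))

lemma definable_comp2:
  assumes "definable (\<lambda>v. P (v 0) (v (Suc 0)))" "definable_term t" "definable_term u"
  shows "definable (\<lambda>v. P (t v) (u v))"
proof (rule definable_subst[OF assms(2)], rule definable_subst[OF definable_term_shift[OF assms(3)]])
  show "definable (\<lambda>v. P (v (Suc 0)) (v 0))"
    using definable_reindex[OF assms(1), of "case_nat (Suc 0) (\<lambda>_. 0)"] by simp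
qed

lemma definable_comp3:
  assumes "definable (\<lambda>v. P (v 0) (v (Suc 0)) (v (Suc (Suc 0))))"
    and "definable_term t" "definable_term u" "definable_term w"
  shows "definable (\<lambda>v. P (t v) (u v) (w v))"
proof (rule definable_subst[OF assms(2)], rule definable_subst[OF definable_term_shift[OF assms(3)]],
    rule definable_subst[OF definable_term_shift[OF definable_term_shift[OF assms(4)]]])
  show "definable (\<lambda>v. P (v (Suc (Suc 0))) (v (Suc 0)) (v 0))"
    using definable_reindex[OF assms(1), of "case_nat (Suc (Suc 0)) (case_nat (Suc 0) (\<lambda>_. 0))"]
    by simp
qed

lemma definable_mem [df]:
  "definable_term t \<Longrightarrow> definable_term u \<Longrightarrow> definable (\<lambda>v. t v \<in>\<^sub>M u v)"
  by (rule definable_comp2[where P = "(\<in>\<^sub>M)"]) (rule definable.mem)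

lemma definable_eq [df]:
  "definable_term t \<Longrightarrow> definable_term u \<Longrightarrow> definable (\<lambda>v. t v = u v)"
  by (rule definable_comp2[where P = "(=)"]) (rule definable.eq)

lemma definable_term_comp1:
  assumes "definable (\<lambda>v. v 0 = f (v (Suc 0)))" "definable_term t"
  shows "definable_term (\<lambda>v. f (t v))"
  unfolding definable_term_def
  by (rule definable_comp2[where P = "\<lambda>z x. z = f x"])
    (rule assms(1) definable_term_var definable_term_shift[OF assms(2)])+

lemma definable_term_comp2:
  assumes "definable (\<lambda>v. v 0 = f (v (Suc 0)) (v (Suc (Suc 0))))"
    and "definable_term t" "definable_term u"
  shows "definable_term (\<lambda>v. f (t v) (u v))"
  unfolding definable_term_def
  by (rule definable_comp3[where P = "\<lambda>z x y. z = f x y"])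
    (rule assms(1) definable_term_var definable_term_shift[OF assms(2)]
      definable_term_shift[OF assms(3)])+

lemma definable_subset_of [df]:
  "definable_term t \<Longrightarrow> definable_term u \<Longrightarrow> definable (\<lambda>v. subset_of (t v) (u v))"
  by (rule definable_comp2[where P = subset_of]) (unfold subset_of_def, intro df)

end

section \<open>Separation for definable predicates\<close>

context ZF
begin

lemma separation_definable:
  assumes "definable P"
  shows "\<exists>B. \<forall>x. x \<in>\<^sub>M B \<longleftrightarrow> x \<in>\<^sub>M A \<and> P (case_nat x u)"
proof -
  obtain \<phi> ws where P: "\<And>v. P v \<longleftrightarrow> sat (\<in>\<^sub>M) (shift_env ws v) \<phi>"
    using definable_sat[OF assms] by blast
  \<comment> \<open>The schema binds variable 0, but the representation puts the parameters first;
    \<open>f\<close> rotates the bound variable from behind the parameters to the front.\<close>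
  define f where "f i = (if i < length ws then Suc i else if i = length ws then 0 else i)" for i
  have "inj f" by (auto simp: inj_def f_def split: if_splits)
  moreover have "(shift_env (undefined # ws) u)(0 := x) \<circ> f = shift_env ws (case_nat x u)" for x
  proof
    fix i
    consider "i < length ws" | "i = length ws" | k where "i = Suc (length ws + k)"
      by (metis less_imp_Suc_add linorder_neqE_nat)
    then show "((shift_env (undefined # ws) u)(0 := x) \<circ> f) i = shift_env ws (case_nat x u) i"
      by cases (auto simp: shift_env_def f_def)
  qed
  ultimately show ?thesis
    using separation[of A "shift_env (undefined # ws) u" "rename f \<phi>"]
    by (simp add: P sat_rename)
qed

lemma ex_sep:
  assumes "definable (\<lambda>v. P (v 0))"
  shows "\<exists>B. \<forall>x. x \<in>\<^sub>M B \<longleftrightarrow> x \<in>\<^sub>M A \<and> P x"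
  using separation_definable[OF assms] by simp

lemma ex_upair_graph: "definable (\<lambda>v. v 0 = upair (v (Suc 0)) (v (Suc (Suc 0))))"
  unfolding eq_upair_iff by (intro df)

lemmas definable_term_upair [df] = definable_term_comp2[OF ex_upair_graph]

lemma definable_term_pair [df]:
  "definable_term t \<Longrightarrow> definable_term u \<Longrightarrow> definable_term (\<lambda>v. pair (t v) (u v))"
  unfolding pair_def by (intro df)

lemma definable_maps [df]:
  "definable_term t \<Longrightarrow> definable_term u \<Longrightarrow> definable_term w \<Longrightarrow>
    definable (\<lambda>v. maps (t v) (u v) (w v))"
  by (rule definable_comp3[where P = maps]) (unfold maps_def Ex1_def, intro df)

section \<open>Natural numbers and inductive relations\<close>

lemma extensionality_iff: "A = B \<longleftrightarrow> (\<forall>x. x \<in>\<^sub>M A \<longleftrightarrow> x \<in>\<^sub>M B)"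
  using extensionality by blast

definition emp :: 'a where "emp = coll (\<lambda>_. False)"

definition succ :: "'a \<Rightarrow> 'a" where "succ n = coll (\<lambda>x. x \<in>\<^sub>M n \<or> x = n)"

definition union_of :: "'a \<Rightarrow> 'a" where "union_of C = coll (\<lambda>x. \<exists>B. B \<in>\<^sub>M C \<and> x \<in>\<^sub>M B)"

lemma mem_emp [simp]: "\<not> x \<in>\<^sub>M emp"
proof -
  have "definable (\<lambda>v. v 0 \<noteq> v 0)" by (intro df)
  from ex_sep[of "\<lambda>x. x \<noteq> x", OF this]
  have "\<exists>A. \<forall>x. x \<in>\<^sub>M A \<longleftrightarrow> False" by simp
  from coll_iff[OF this] show ?thesis by (simp add: emp_def)
qed

lemma mem_succ [simp]: "x \<in>\<^sub>M succ n \<longleftrightarrow> x \<in>\<^sub>M n \<or> x = n"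
proof -
  have "\<exists>A. \<forall>x. x \<in>\<^sub>M A \<longleftrightarrow> x \<in>\<^sub>M n \<or> x = n"
    using ex_bin_union[of n "upair n n"] by (simp add: mem_upair_iff)
  from coll_iff[OF this] show ?thesis by (simp add: succ_def)
qed

lemma mem_union_of [simp]: "x \<in>\<^sub>M union_of C \<longleftrightarrow> (\<exists>B. B \<in>\<^sub>M C \<and> x \<in>\<^sub>M B)"
  unfolding union_of_def by (rule coll_iff[OF union])

lemma definable_term_succ [df]: "definable_term t \<Longrightarrow> definable_term (\<lambda>v. succ (t v))"
  by (rule definable_term_comp1) (unfold extensionality_iff mem_succ, intro df)

lemma definable_term_union_of [df]: "definable_term t \<Longrightarrow> definable_term (\<lambda>v. union_of (t v))"
  by (rule definable_term_comp1) (unfold extensionality_iff mem_union_of, intro df)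

lemma not_mem_self: "\<not> x \<in>\<^sub>M x"
  using foundation[of x "upair x x"] by (auto simp: mem_upair_iff)

lemma not_mem_cycle: "x \<in>\<^sub>M y \<Longrightarrow> \<not> y \<in>\<^sub>M x"
  using foundation[of x "upair x y"] by (auto simp: mem_upair_iff)

lemma succ_inject [simp]: "succ m = succ n \<longleftrightarrow> m = n"
  by (metis mem_succ not_mem_cycle)

lemma succ_neq_emp [simp]: "succ n \<noteq> emp" "emp \<noteq> succ n"
  by (metis mem_emp mem_succ)+

lemma emp_eqI: "(\<And>x. \<not> x \<in>\<^sub>M e) \<Longrightarrow> e = emp"
  by (simp add: extensionality_iff)

lemma is_inductive_iff: "is_inductive I \<longleftrightarrow> emp \<in>\<^sub>M I \<and> (\<forall>n. n \<in>\<^sub>M I \<longrightarrow> succ n \<in>\<^sub>M I)"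
proof -
  have 1: "(\<forall>x. \<not> x \<in>\<^sub>M e) \<longleftrightarrow> e = emp" for e by (auto intro: emp_eqI)
  have 2: "(\<forall>x. x \<in>\<^sub>M s \<longleftrightarrow> x \<in>\<^sub>M n \<or> x = n) \<longleftrightarrow> s = succ n" for s n
    by (simp add: extensionality_iff)
  show ?thesis unfolding is_inductive_def 1 2 by auto
qed

lemma emp_in_omega [simp]: "emp \<in>\<^sub>M omega"
  by (simp add: mem_omega_iff is_inductive_iff)

lemma succ_in_omega [simp]: "n \<in>\<^sub>M omega \<Longrightarrow> succ n \<in>\<^sub>M omega"
  by (simp add: mem_omega_iff is_inductive_iff)

text \<open>The inductive set is cut out of \<open>omega\<close> by separation, hence the
  definability premise.\<close>

lemma omega_induct [consumes 1, case_names definable zero succ]: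
  assumes "n \<in>\<^sub>M omega" "definable (\<lambda>v. P (v 0))"
    and "P emp" "\<And>n. n \<in>\<^sub>M omega \<Longrightarrow> P n \<Longrightarrow> P (succ n)"
  shows "P n"
proof -
  obtain I where I: "\<forall>x. x \<in>\<^sub>M I \<longleftrightarrow> x \<in>\<^sub>M omega \<and> P x" using ex_sep[OF assms(2)] by blast
  then have "is_inductive I" using assms(3,4) by (simp add: is_inductive_iff)
  then show ?thesis using assms(1) I unfolding mem_omega_iff by blast
qed

lemma omega_trans: "n \<in>\<^sub>M omega \<Longrightarrow> \<forall>m. m \<in>\<^sub>M n \<longrightarrow> m \<in>\<^sub>M omega"
proof (induction n rule: omega_induct)
  case definable
  show ?case by (intro df)
qed auto

lemma emp_least: "n \<in>\<^sub>M omega \<Longrightarrow> emp = n \<or> emp \<in>\<^sub>M n"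
proof (induction n rule: omega_induct)
  case definable
  show ?case by (intro df)
qed auto

lemma succ_least: "n \<in>\<^sub>M omega \<Longrightarrow> \<forall>m. m \<in>\<^sub>M n \<longrightarrow> succ m = n \<or> succ m \<in>\<^sub>M n"
proof (induction n rule: omega_induct)
  case definable
  show ?case by (intro df)
qed auto

lemma omega_linear: "m \<in>\<^sub>M omega \<Longrightarrow> \<forall>n. n \<in>\<^sub>M omega \<longrightarrow> m = n \<or> m \<in>\<^sub>M n \<or> n \<in>\<^sub>M m"
proof (induction m rule: omega_induct)
  case definable
  show ?case by (intro df)
next
  case zero
  show ?case using emp_least by blast
next
  case (succ m)
  then show ?case using succ_least by auto
qed

lemma ex_minimal:
  assumes "definable (\<lambda>v. P (v 0))" "x \<in>\<^sub>M A" "P x"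
  shows "\<exists>m. m \<in>\<^sub>M A \<and> P m \<and> (\<forall>z. z \<in>\<^sub>M m \<longrightarrow> z \<in>\<^sub>M A \<longrightarrow> \<not> P z)"
proof -
  obtain B where "\<forall>x. x \<in>\<^sub>M B \<longleftrightarrow> x \<in>\<^sub>M A \<and> P x" using ex_sep[OF assms(1)] by blast
  then show ?thesis using foundation[of x B] assms by blast
qed

text \<open>Kuratowski pairs over \<open>A\<close> lie in its double power set. The bound also
  includes \<open>A\<close> itself, so that iterating it bounds nested tuples of varying
  depth.\<close>

lemma pair_bound: "\<exists>B. \<forall>x y. x \<in>\<^sub>M A \<longrightarrow> y \<in>\<^sub>M A \<longrightarrow> x \<in>\<^sub>M B \<and> pair x y \<in>\<^sub>M B"
proof -
  obtain B where B: "\<forall>x. x \<in>\<^sub>M B \<longleftrightarrow> x \<in>\<^sub>M A \<or> x \<in>\<^sub>M pow (pow A)" using ex_bin_union by blast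
  have "pair x y \<in>\<^sub>M pow (pow A)" if "x \<in>\<^sub>M A" "y \<in>\<^sub>M A" for x y
    using that by (auto simp: pair_def mem_pow_iff subset_of_def mem_upair_iff)
  then show ?thesis using B by blast
qed

section \<open>Inductively generated sets inside the model\<close>

definition reachable :: "('a \<Rightarrow> bool) \<Rightarrow> ('a \<Rightarrow> 'a \<Rightarrow> bool) \<Rightarrow> 'a \<Rightarrow> bool" where
  "reachable S R y \<longleftrightarrow>
     (\<forall>Z. (\<forall>x. S x \<longrightarrow> x \<in>\<^sub>M Z) \<and> (\<forall>x y. x \<in>\<^sub>M Z \<longrightarrow> R x y \<longrightarrow> y \<in>\<^sub>M Z) \<longrightarrow> y \<in>\<^sub>M Z)"

text \<open>The closed set \<open>W\<close> prevents \<open>reachable\<close> from being vacuously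
  true of everything, and it is the set from which separation carves.\<close>

definition set_system :: "('a \<Rightarrow> bool) \<Rightarrow> ('a \<Rightarrow> 'a \<Rightarrow> bool) \<Rightarrow> bool" where
  "set_system S R \<longleftrightarrow> definable (\<lambda>v. S (v 0)) \<and> definable (\<lambda>v. R (v 0) (v (Suc 0))) \<and>
     (\<exists>W. (\<forall>x. S x \<longrightarrow> x \<in>\<^sub>M W) \<and> (\<forall>x y. x \<in>\<^sub>M W \<longrightarrow> R x y \<longrightarrow> y \<in>\<^sub>M W))"

lemma reachable_start: "S x \<Longrightarrow> reachable S R x"
  unfolding reachable_def by blast

lemma reachable_step: "reachable S R x \<Longrightarrow> R x y \<Longrightarrow> reachable S R y"
  unfolding reachable_def by blast

lemma definable_reachable:
  assumes "set_system S R" "definable_term t"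
  shows "definable (\<lambda>v. reachable S R (t v))"
proof -
  have S: "definable_term t \<Longrightarrow> definable (\<lambda>v. S (t v))" for t
    using assms(1) by (auto simp: set_system_def intro: definable_comp1)
  have R: "definable_term t \<Longrightarrow> definable_term u \<Longrightarrow> definable (\<lambda>v. R (t v) (u v))" for t u
    using assms(1) by (auto simp: set_system_def intro: definable_comp2[where P = R])
  show ?thesis
    by (rule definable_comp1[OF _ assms(2)]) (unfold reachable_def, intro df S R)
qed

text \<open>The members of \<open>W\<close> that are reachable and satisfy \<open>P\<close> form a
  set containing the starts and closed under steps. Keeping reachability in this set makes it
  available in the step case.\<close>

lemma reachable_induct [consumes 2, case_names definable start step]:
  assumes "set_system S R" "reachable S R y" "definable (\<lambda>v. P (v 0))"
    and "\<And>x. S x \<Longrightarrow> P x" "\<And>x y. reachable S R x \<Longrightarrow> P x \<Longrightarrow> R x y \<Longrightarrow> P y"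
  shows "P y"
proof -
  obtain W where W: "\<forall>x. S x \<longrightarrow> x \<in>\<^sub>M W" "\<forall>x y. x \<in>\<^sub>M W \<longrightarrow> R x y \<longrightarrow> y \<in>\<^sub>M W"
    using assms(1) unfolding set_system_def by blast
  have "definable (\<lambda>v. reachable S R (v 0) \<and> P (v 0))"
    by (intro df definable_reachable assms)
  then obtain Z where Z: "\<forall>x. x \<in>\<^sub>M Z \<longleftrightarrow> x \<in>\<^sub>M W \<and> reachable S R x \<and> P x"
    using ex_sep[of "\<lambda>x. reachable S R x \<and> P x"] by blast
  have "(\<forall>x. S x \<longrightarrow> x \<in>\<^sub>M Z) \<and> (\<forall>x y. x \<in>\<^sub>M Z \<longrightarrow> R x y \<longrightarrow> y \<in>\<^sub>M Z)"
    using Z W assms(4,5) reachable_start reachable_step by metis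
  then have "y \<in>\<^sub>M Z" using assms(2) unfolding reachable_def by blast
  then show ?thesis using Z by blast
qed

lemma reachable_cases:
  assumes "set_system S R" "reachable S R y"
  shows "S y \<or> (\<exists>x. reachable S R x \<and> R x y)"
  using assms
proof (induction rule: reachable_induct)
  case definable
  have S: "definable (\<lambda>v. S (v 0))" and R: "definable (\<lambda>v. R (v 0) (v (Suc 0)))"
    using assms(1) by (auto simp: set_system_def)
  show ?case
    by (intro df definable_reachable assms definable_comp1[OF S] definable_comp2[OF R])
qed auto

text \<open>Unique decoding, used for doubling, for the pairing and for sequence codes. Induction on
  one derivation, with inversion of the last step of the other: mixed cases are excluded, and two
  steps with the same result come from the same code, to which the induction hypothesis
  applies.\<close>

lemma reachable_left_unique:
  assumes sys: "set_system S R"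
    and start: "\<And>p. S p \<Longrightarrow> \<exists>s y. p = pair s y"
    and step: "\<And>p q. R p q \<Longrightarrow> \<exists>s y t z. p = pair s y \<and> q = pair t z"
    and start_start: "\<And>s s' y. S (pair s y) \<Longrightarrow> S (pair s' y) \<Longrightarrow> s = s'"
    and start_step: "\<And>s s' y p. S (pair s y) \<Longrightarrow> reachable S R p \<Longrightarrow> R p (pair s' y) \<Longrightarrow> False"
    and step_step: "\<And>s y t z s' y' t'. reachable S R (pair s y) \<Longrightarrow> reachable S R (pair s' y') \<Longrightarrow>
      R (pair s y) (pair t z) \<Longrightarrow> R (pair s' y') (pair t' z) \<Longrightarrow> y = y' \<and> (s = s' \<longrightarrow> t = t')"
    and "reachable S R (pair s y)" "reachable S R (pair s' y)"
  shows "s = s'"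
proof -
  have "\<forall>s y s'. p = pair s y \<longrightarrow> reachable S R (pair s' y) \<longrightarrow> s = s'"
    if "reachable S R p" for p
    using sys that
  proof (induction rule: reachable_induct)
    case definable
    show ?case by (intro df definable_reachable sys)
  next
    case (start p)
    then show ?case using reachable_cases[OF sys] start_start start_step by blast
  next
    case (step p q)
    show ?case
    proof (intro allI impI)
      fix s y s' assume q: "q = pair s y" and r: "reachable S R (pair s' y)"
      obtain s0 y0 where p: "p = pair s0 y0" using assms(3)[OF step.hyps(2)] by blast
      from reachable_cases[OF sys r] show "s = s'"
      proof
        assume "S (pair s' y)"
        then show ?thesis using start_step step.hyps q by blast
      next
        assume "\<exists>x. reachable S R x \<and> R x (pair s' y)"
        then obtain p' where p': "reachable S R p'" "R p' (pair s' y)" by blast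
        moreover obtain s1 y1 where "p' = pair s1 y1" using assms(3)[OF p'(2)] by blast
        ultimately show ?thesis
          using step_step[of s0 y0 s1 y1 s y s'] step.hyps step.IH p q by blast
      qed
    qed
  qed
  then show ?thesis using assms(7,8) by blast
qed

section \<open>A pairing of the natural numbers\<close>

text \<open>Doubling is given by its graph, generated from (0, 0) by adding 1 and 2 to the
  components.\<close>

definition double_start :: "'a \<Rightarrow> bool" where
  "double_start p \<longleftrightarrow> p = pair emp emp"

definition double_step :: "'a \<Rightarrow> 'a \<Rightarrow> bool" where
  "double_step p q \<longleftrightarrow> (\<exists>n k. n \<in>\<^sub>M omega \<and> k \<in>\<^sub>M omega \<and> p = pair n k \<and> q = pair (succ n) (succ (succ k)))"

definition double :: "'a \<Rightarrow> 'a \<Rightarrow> bool" where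
  "double n k \<longleftrightarrow> reachable double_start double_step (pair n k)"

lemma double_system: "set_system double_start double_step"
  unfolding set_system_def
proof (intro conjI)
  show "definable (\<lambda>v. double_start (v 0))" unfolding double_start_def by (intro df)
  show "definable (\<lambda>v. double_step (v 0) (v (Suc 0)))" unfolding double_step_def by (intro df)
  obtain W where "\<forall>x y. x \<in>\<^sub>M omega \<longrightarrow> y \<in>\<^sub>M omega \<longrightarrow> x \<in>\<^sub>M W \<and> pair x y \<in>\<^sub>M W"
    using pair_bound by blast
  then show "\<exists>W. (\<forall>x. double_start x \<longrightarrow> x \<in>\<^sub>M W) \<and> (\<forall>x y. x \<in>\<^sub>M W \<longrightarrow> double_step x y \<longrightarrow> y \<in>\<^sub>M W)"
    unfolding double_start_def double_step_def by (intro exI[of _ W]) auto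
qed

lemma definable_double [df]:
  "definable_term t \<Longrightarrow> definable_term u \<Longrightarrow> definable (\<lambda>v. double (t v) (u v))"
  unfolding double_def by (intro df definable_reachable double_system)

lemma double_cases:
  assumes "double n k"
  shows "n = emp \<and> k = emp \<or> (\<exists>m l. double m l \<and> n = succ m \<and> k = succ (succ l))"
  using reachable_cases[OF double_system assms[unfolded double_def]]
  by (auto simp: double_start_def double_step_def double_def pair_inject)

lemma double_in_omega:
  assumes "double n k"
  shows "n \<in>\<^sub>M omega \<and> k \<in>\<^sub>M omega"
  using reachable_cases[OF double_system assms[unfolded double_def]]
  by (auto simp: double_start_def double_step_def pair_inject)

lemma double_step_intro: "double n k \<Longrightarrow> double (succ n) (succ (succ k))"
  using double_in_omega[of n k] reachable_step[of double_start double_step "pair n k"]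
  unfolding double_def double_step_def by blast

lemma ex_double: "n \<in>\<^sub>M omega \<Longrightarrow> \<exists>k. double n k"
proof (induction n rule: omega_induct)
  case definable
  show ?case by (intro df)
next
  case zero
  show ?case using reachable_start[of double_start "pair emp emp"]
    unfolding double_def double_start_def by blast
qed (auto dest: double_step_intro)

lemma double_left_unique: "double m k \<Longrightarrow> double n k \<Longrightarrow> m = n"
  unfolding double_def
  by (rule reachable_left_unique[OF double_system])
    (auto simp: double_start_def double_step_def pair_inject)

text \<open>Parity: peeling two successors off both numbers reduces a collision of an even with an
  odd number to a smaller one.\<close>

lemma double_not_odd: "m \<in>\<^sub>M omega \<Longrightarrow> \<forall>k n l. double m k \<longrightarrow> double n l \<longrightarrow> k \<noteq> succ l \<and> l \<noteq> succ k"
proof (induction m rule: omega_induct)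
  case definable
  show ?case by (intro df)
next
  case zero
  show ?case using double_cases by (metis succ_inject succ_neq_emp)
next
  case (succ m)
  then show ?case using double_cases by (metis succ_inject succ_neq_emp)
qed

text \<open>The relation \<open>code m n k\<close> expresses \<open>k = 2\<^sup>m (2 n + 1)\<close>.\<close>

definition code_start :: "'a \<Rightarrow> bool" where
  "code_start p \<longleftrightarrow> (\<exists>n k. double n k \<and> p = pair (pair emp n) (succ k))"

definition code_step :: "'a \<Rightarrow> 'a \<Rightarrow> bool" where
  "code_step p q \<longleftrightarrow> (\<exists>m n k l. m \<in>\<^sub>M omega \<and> n \<in>\<^sub>M omega \<and> double k l \<and> k \<noteq> emp \<and>
     p = pair (pair m n) k \<and> q = pair (pair (succ m) n) l)"

definition code :: "'a \<Rightarrow> 'a \<Rightarrow> 'a \<Rightarrow> bool" where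
  "code m n k \<longleftrightarrow> reachable code_start code_step (pair (pair m n) k)"

lemma code_system: "set_system code_start code_step"
  unfolding set_system_def
proof (intro conjI)
  show "definable (\<lambda>v. code_start (v 0))" unfolding code_start_def by (intro df)
  show "definable (\<lambda>v. code_step (v 0) (v (Suc 0)))" unfolding code_step_def by (intro df)
  obtain V where V: "\<forall>x y. x \<in>\<^sub>M omega \<longrightarrow> y \<in>\<^sub>M omega \<longrightarrow> x \<in>\<^sub>M V \<and> pair x y \<in>\<^sub>M V"
    using pair_bound by blast
  obtain W where "\<forall>x y. x \<in>\<^sub>M V \<longrightarrow> y \<in>\<^sub>M V \<longrightarrow> x \<in>\<^sub>M W \<and> pair x y \<in>\<^sub>M W"
    using pair_bound by blast
  then have "pair (pair m n) k \<in>\<^sub>M W" if "m \<in>\<^sub>M omega" "n \<in>\<^sub>M omega" "k \<in>\<^sub>M omega" for m n k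
    using V that by blast
  then show "\<exists>W. (\<forall>x. code_start x \<longrightarrow> x \<in>\<^sub>M W) \<and> (\<forall>x y. x \<in>\<^sub>M W \<longrightarrow> code_step x y \<longrightarrow> y \<in>\<^sub>M W)"
    unfolding code_start_def code_step_def using double_in_omega
    by (intro exI[of _ W]) auto
qed

lemma definable_code [df]:
  "definable_term t \<Longrightarrow> definable_term u \<Longrightarrow> definable_term w \<Longrightarrow>
    definable (\<lambda>v. code (t v) (u v) (w v))"
  unfolding code_def by (intro df definable_reachable code_system)

lemma double_neq_emp: "double k l \<Longrightarrow> k \<noteq> emp \<Longrightarrow> l \<noteq> emp"
  using double_cases by (metis succ_neq_emp)

text \<open>That codes are nonzero matters later: \<open>a\<close> is the image of 0 under
  \<open>e\<close>, so it stays outside the range of the initial pairing.\<close>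

lemma code_in_omega:
  assumes "code m n k"
  shows "m \<in>\<^sub>M omega \<and> n \<in>\<^sub>M omega \<and> k \<in>\<^sub>M omega \<and> k \<noteq> emp"
  using reachable_cases[OF code_system assms[unfolded code_def]]
  by (auto simp: code_start_def code_step_def pair_inject dest: double_in_omega double_neq_emp)

lemma ex_code: "m \<in>\<^sub>M omega \<Longrightarrow> \<forall>n. n \<in>\<^sub>M omega \<longrightarrow> (\<exists>k. code m n k)"
proof (induction m rule: omega_induct)
  case definable
  show ?case by (intro df)
next
  case zero
  show ?case
    using ex_double reachable_start[of code_start] unfolding code_def code_start_def by blast
next
  case (succ m)
  show ?case
  proof (intro allI impI)
    fix n assume n: "n \<in>\<^sub>M omega"
    then obtain k where k: "code m n k" using succ.IH by blast
    obtain l where l: "double k l" using ex_double code_in_omega[OF k] by blast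
    have "code_step (pair (pair m n) k) (pair (pair (succ m) n) l)"
      unfolding code_step_def using k l n succ.hyps code_in_omega[OF k] by blast
    then show "\<exists>k. code (succ m) n k"
      using k reachable_step[of code_start code_step] unfolding code_def by blast
  qed
qed

text \<open>A start yields an odd number and a step an even one, so they never collide; doubling and
  its shift by one are injective.\<close>

lemma code_left_unique:
  assumes "code m n k" "code m' n' k"
  shows "m = m' \<and> n = n'"
proof -
  have "pair m n = pair m' n'"
    using assms unfolding code_def
  proof (rule reachable_left_unique[OF code_system, rotated -2])
    show "code_start (pair s y) \<Longrightarrow> code_start (pair s' y) \<Longrightarrow> s = s'" for s s' y
      by (auto simp: code_start_def pair_inject dest: double_left_unique)
    show "code_step p (pair s' y) \<Longrightarrow> False" if "code_start (pair s y)" for s s' y p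
      using that double_not_odd double_in_omega unfolding code_start_def code_step_def pair_inject
      by blast
    show "y = y' \<and> (s = s' \<longrightarrow> t = t')"
      if "code_step (pair s y) (pair t z)" "code_step (pair s' y') (pair t' z)" for s y t z s' y' t'
      using that by (auto simp: code_step_def pair_inject dest: double_left_unique)
  qed (auto simp: code_start_def code_step_def)
  then show ?thesis by (simp add: pair_inject)
qed

section \<open>A fixed point theorem\<close>

text \<open>
  As in the proof of Zorn's lemma in the HOL library, closure under unions of all subfamilies is demanded;
  that the tower is a chain is derived.
\<close>

definition tower :: "('a \<Rightarrow> 'a) \<Rightarrow> 'a \<Rightarrow> bool" where
  "tower f x \<longleftrightarrow> (\<forall>Z. (\<forall>x. x \<in>\<^sub>M Z \<longrightarrow> f x \<in>\<^sub>M Z) \<and>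
     (\<forall>C. subset_of C Z \<longrightarrow> union_of C \<in>\<^sub>M Z) \<longrightarrow> x \<in>\<^sub>M Z)"

lemma subset_of_refl: "subset_of x x" by (simp add: subset_of_def)

lemma subset_of_trans: "subset_of x y \<Longrightarrow> subset_of y z \<Longrightarrow> subset_of x z"
  by (simp add: subset_of_def)

lemma subset_of_antisym: "subset_of x y \<Longrightarrow> subset_of y x \<Longrightarrow> x = y"
  by (auto simp: subset_of_def extensionality_iff)

text \<open>The tower lies in \<open>pow U\<close>, hence is a set, and its union is its largest
  member, which \<open>f\<close> cannot enlarge. The property \<open>P\<close> is inherited along
  the tower, its start \<open>emp\<close> being the union of the empty chain.\<close>

lemma ex_fixed_point:
  assumes f: "definable (\<lambda>v. v 0 = f (v (Suc 0)))" and P: "definable (\<lambda>v. P (v 0))"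
    and infl: "\<And>x. subset_of x U \<Longrightarrow> subset_of x (f x) \<and> subset_of (f x) U"
    and P_step: "\<And>x. subset_of x U \<Longrightarrow> P x \<Longrightarrow> P (f x)"
    and P_chain: "\<And>C. (\<And>x. x \<in>\<^sub>M C \<Longrightarrow> P x) \<Longrightarrow>
      (\<And>x y. x \<in>\<^sub>M C \<Longrightarrow> y \<in>\<^sub>M C \<Longrightarrow> subset_of x y \<or> subset_of y x) \<Longrightarrow> P (union_of C)"
  shows "\<exists>x. P x \<and> f x = x"
proof -
  note f_df = definable_term_comp1[OF f]
  have tower_df: "definable_term t \<Longrightarrow> definable (\<lambda>v. tower f (t v))" for t
    by (rule definable_comp1[where P = "tower f"]) (unfold tower_def, intro df f_df)
  have tower_step: "tower f (f x)" if "tower f x" for x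
    using that unfolding tower_def by blast
  have tower_union: "tower f (union_of C)" if "\<And>x. x \<in>\<^sub>M C \<Longrightarrow> tower f x" for C
    unfolding tower_def
  proof (intro allI impI)
    fix Z
    assume Z: "(\<forall>x. x \<in>\<^sub>M Z \<longrightarrow> f x \<in>\<^sub>M Z) \<and> (\<forall>C. subset_of C Z \<longrightarrow> union_of C \<in>\<^sub>M Z)"
    then have "subset_of C Z" using that by (auto simp: tower_def subset_of_def)
    then show "union_of C \<in>\<^sub>M Z" using Z by blast
  qed
  \<comment> \<open>Induction over the tower: the members below \<open>U\<close> that satisfy
    \<open>Q\<close> form a set closed under \<open>f\<close> and unions, so it contains the whole
    tower.\<close>
  have induct: "Q x" if "tower f x" "definable (\<lambda>v. Q (v 0))"
    and Q_step: "\<And>x. tower f x \<Longrightarrow> subset_of x U \<Longrightarrow> Q x \<Longrightarrow> Q (f x)"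
    and Q_union: "\<And>C. (\<And>x. x \<in>\<^sub>M C \<Longrightarrow> tower f x \<and> Q x) \<Longrightarrow> Q (union_of C)" for Q x
  proof -
    have "definable (\<lambda>v. tower f (v 0) \<and> Q (v 0))" by (intro df tower_df that)
    then obtain Z where Z: "\<forall>x. x \<in>\<^sub>M Z \<longleftrightarrow> x \<in>\<^sub>M pow U \<and> tower f x \<and> Q x"
      using ex_sep[of "\<lambda>x. tower f x \<and> Q x"] by blast
    have "x \<in>\<^sub>M Z"
    proof (rule \<open>tower f x\<close>[unfolded tower_def, rule_format], intro conjI allI impI)
      fix x assume "x \<in>\<^sub>M Z"
      then show "f x \<in>\<^sub>M Z" using Z infl Q_step tower_step by (simp add: mem_pow_iff)
    next
      fix C assume "subset_of C Z"
      then have "\<And>x. x \<in>\<^sub>M C \<Longrightarrow> x \<in>\<^sub>M Z" by (simp add: subset_of_def)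
      then show "union_of C \<in>\<^sub>M Z"
        using Z Q_union tower_union by (auto simp: mem_pow_iff subset_of_def)
    qed
    then show ?thesis using Z by blast
  qed
  have bound: "subset_of x U" if "tower f x" for x
    using that
  proof (rule induct)
    show "definable (\<lambda>v. subset_of (v 0) U)" by (intro df)
  qed (use infl in \<open>auto simp: subset_of_def\<close>)
  \<comment> \<open>The hypothesis on \<open>y\<close> makes it extremal: \<open>f\<close> does not
    carry a smaller tower element beyond it. Such a \<open>y\<close> splits the tower at
    \<open>y\<close> and \<open>f y\<close>.\<close>
  have total_aux: "subset_of x y \<or> subset_of (f y) x"
    if "tower f x" "tower f y"
      and *: "\<And>z. tower f z \<Longrightarrow> subset_of z y \<Longrightarrow> z = y \<or> subset_of (f z) y" for x y
    using \<open>tower f x\<close>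
  proof (rule induct)
    show "definable (\<lambda>v. subset_of (v 0) y \<or> subset_of (f y) (v 0))" by (intro df)
  next
    fix x assume "tower f x" "subset_of x U" "subset_of x y \<or> subset_of (f y) x"
    then show "subset_of (f x) y \<or> subset_of (f y) (f x)"
      using * infl subset_of_trans subset_of_refl by metis
  next
    fix C assume C: "\<And>x. x \<in>\<^sub>M C \<Longrightarrow> tower f x \<and> (subset_of x y \<or> subset_of (f y) x)"
    then show "subset_of (union_of C) y \<or> subset_of (f y) (union_of C)"
      by (auto simp: subset_of_def)
  qed
  \<comment> \<open>Every tower element is extremal, which turns the previous comparison into
    linearity of the tower.\<close>
  have succ_le: "\<forall>y. tower f y \<longrightarrow> subset_of y x \<longrightarrow> x = y \<or> subset_of (f y) x"
    if "tower f x" for x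
    using that
  proof (rule induct)
    show "definable (\<lambda>v. \<forall>y. tower f y \<longrightarrow> subset_of y (v 0) \<longrightarrow> v 0 = y \<or> subset_of (f y) (v 0))"
      by (intro df tower_df f_df)
  next
    fix x assume x: "tower f x" "subset_of x U"
      and IH: "\<forall>y. tower f y \<longrightarrow> subset_of y x \<longrightarrow> x = y \<or> subset_of (f y) x"
    show "\<forall>y. tower f y \<longrightarrow> subset_of y (f x) \<longrightarrow> f x = y \<or> subset_of (f y) (f x)"
    proof (intro allI impI)
      fix y assume y: "tower f y" "subset_of y (f x)"
      have "subset_of y x \<or> subset_of (f x) y"
        using total_aux[OF y(1) x(1)] IH by blast
      then show "f x = y \<or> subset_of (f y) (f x)"
        using IH y x infl subset_of_antisym subset_of_trans subset_of_refl by metis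
    qed
  next
    fix C assume C: "\<And>x. x \<in>\<^sub>M C \<Longrightarrow>
      tower f x \<and> (\<forall>y. tower f y \<longrightarrow> subset_of y x \<longrightarrow> x = y \<or> subset_of (f y) x)"
    show "\<forall>y. tower f y \<longrightarrow> subset_of y (union_of C) \<longrightarrow>
      union_of C = y \<or> subset_of (f y) (union_of C)"
    proof (intro allI impI)
      fix y assume y: "tower f y" "subset_of y (union_of C)"
      show "union_of C = y \<or> subset_of (f y) (union_of C)"
      \<comment> \<open>Either \<open>y\<close> bounds the family and equals its union, or some
        extremal member \<open>x\<close> is not below \<open>y\<close> and therefore contains
        \<open>f y\<close>.\<close>
      proof (cases "\<forall>x. x \<in>\<^sub>M C \<longrightarrow> subset_of x y")
        case True
        then have "subset_of (union_of C) y" by (auto simp: subset_of_def)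
        then show ?thesis using y subset_of_antisym by blast
      next
        case False
        then obtain x where x: "x \<in>\<^sub>M C" "\<not> subset_of x y" by blast
        have "subset_of y x \<or> subset_of (f x) y"
          using total_aux[OF y(1), of x] C[OF x(1)] by blast
        moreover have "\<not> subset_of (f x) y"
          using x(2) infl[OF bound] C[OF x(1)] subset_of_trans by blast
        ultimately have "subset_of (f y) x"
          using C[OF x(1)] y(1) x(2) subset_of_refl by blast
        then show ?thesis using x(1) by (auto simp: subset_of_def)
      qed
    qed
  qed
  have total: "subset_of x y \<or> subset_of y x" if "tower f x" "tower f y" for x y
    using total_aux[OF that] succ_le[OF that(2)] infl[OF bound[OF that(2)]] subset_of_trans by metis
  have P_all: "P x" if "tower f x" for x
    using that P
  proof (rule induct)
    fix C assume "\<And>x. x \<in>\<^sub>M C \<Longrightarrow> tower f x \<and> P x"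
    then show "P (union_of C)" using P_chain total by blast
  qed (rule P_step)
  have "definable (\<lambda>v. tower f (v 0))" by (intro tower_df df)
  then obtain T where "\<forall>x. x \<in>\<^sub>M T \<longleftrightarrow> x \<in>\<^sub>M pow U \<and> tower f x"
    using ex_sep[of "tower f"] by blast
  then have T: "\<And>x. x \<in>\<^sub>M T \<longleftrightarrow> tower f x" using bound by (auto simp: mem_pow_iff)
  have "tower f (union_of T)" using tower_union T by blast
  moreover have "subset_of (f (union_of T)) (union_of T)"
    using T tower_step[OF calculation] by (auto simp: subset_of_def)
  ultimately show ?thesis using P_all infl[OF bound] subset_of_antisym by blast
qed

end

section \<open>States of the transfinite construction\<close>

text \<open>
  \<open>U\<close> is any set that contains all tagged tuples from which states are built.
\<close>

locale set_with_coding = ZF +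
  fixes X F e a b U :: 'a
  assumes injection_F: "injection F (pow X) (finseqs X)"
    and injection_e: "injection e omega X"
    and a: "pair emp a \<in>\<^sub>M e"
    and b: "pair (succ emp) b \<in>\<^sub>M e"
    and U_pre: "x \<in>\<^sub>M X \<Longrightarrow> subset_of I X \<Longrightarrow> pair emp (pair x I) \<in>\<^sub>M U"
    and U_rel: "x \<in>\<^sub>M X \<Longrightarrow> y \<in>\<^sub>M X \<Longrightarrow> z \<in>\<^sub>M X \<Longrightarrow> pair (succ emp) (pair x (pair y z)) \<in>\<^sub>M U"
    and U_cod: "x \<in>\<^sub>M X \<Longrightarrow> t \<in>\<^sub>M X \<Longrightarrow> pair (succ (succ emp)) (pair x t) \<in>\<^sub>M U"
begin

text \<open>
  A state is a set \<open>\<sigma>\<close> of tuples with tags \<open>0\<close>, \<open>1\<close>, \<open>2\<close>. It encodes \<open>S\<close> (\<open>dm\<close>), \<open>B\<close> (\<open>bs\<close>), the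
  well-order of \<open>S\<close>, in which \<open>I\<close> is the set of predecessors of \<open>x\<close> (\<open>pre \<sigma> x I\<close>), the pairing, in
  which \<open>z\<close> codes \<open>(x, y)\<close> (\<open>rel \<sigma> x y z\<close>), and the labels \<open>t\<close> of the elements \<open>x\<close> (\<open>cod \<sigma> x t\<close>).
  Since predecessor sets are recorded, inclusion of states entails end extension of the
  well-orders, and so unions of chains of states are states. Labels are kept when their bearers enter \<open>B\<close>.
\<close>

definition pre :: "'a \<Rightarrow> 'a \<Rightarrow> 'a \<Rightarrow> bool" where
  "pre \<sigma> x I \<longleftrightarrow> pair emp (pair x I) \<in>\<^sub>M \<sigma>"

definition rel :: "'a \<Rightarrow> 'a \<Rightarrow> 'a \<Rightarrow> 'a \<Rightarrow> bool" where
  "rel \<sigma> x y z \<longleftrightarrow> pair (succ emp) (pair x (pair y z)) \<in>\<^sub>M \<sigma>"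

definition cod :: "'a \<Rightarrow> 'a \<Rightarrow> 'a \<Rightarrow> bool" where
  "cod \<sigma> x t \<longleftrightarrow> pair (succ (succ emp)) (pair x t) \<in>\<^sub>M \<sigma>"

definition dm :: "'a \<Rightarrow> 'a \<Rightarrow> bool" where "dm \<sigma> x \<longleftrightarrow> (\<exists>I. pre \<sigma> x I)"

definition bs :: "'a \<Rightarrow> 'a \<Rightarrow> bool" where "bs \<sigma> x \<longleftrightarrow> (\<exists>y z. rel \<sigma> x y z)"

text \<open>A nonrecursive \<open>inductive\<close>, serving as a named conjunction. The order
  conditions describe a well-founded tournament, hence a well-order. Labels need be injective only
  off the base, because labels of elements absorbed into the base may be reissued.\<close>

inductive good :: "'a \<Rightarrow> bool" for \<sigma> where
  goodI: "\<lbrakk>\<And>x I. pre \<sigma> x I \<Longrightarrow> x \<in>\<^sub>M X;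
    \<And>x I u. pre \<sigma> x I \<Longrightarrow> u \<in>\<^sub>M I \<Longrightarrow> dm \<sigma> u;
    \<And>x I J. pre \<sigma> x I \<Longrightarrow> pre \<sigma> x J \<Longrightarrow> I = J;
    \<And>x y I J. pre \<sigma> x I \<Longrightarrow> pre \<sigma> y J \<Longrightarrow> x = y \<or> x \<in>\<^sub>M J \<or> y \<in>\<^sub>M I;
    \<And>Z x. x \<in>\<^sub>M Z \<Longrightarrow> dm \<sigma> x \<Longrightarrow>
       \<exists>x I. x \<in>\<^sub>M Z \<and> pre \<sigma> x I \<and> (\<forall>u. u \<in>\<^sub>M I \<longrightarrow> \<not> u \<in>\<^sub>M Z);
    \<And>x y z. rel \<sigma> x y z \<Longrightarrow> bs \<sigma> y \<and> bs \<sigma> z \<and> z \<noteq> a;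
    \<And>x. bs \<sigma> x \<Longrightarrow> dm \<sigma> x;
    \<And>x y. bs \<sigma> x \<Longrightarrow> bs \<sigma> y \<Longrightarrow> \<exists>z. rel \<sigma> x y z;
    \<And>x y x' y' z. rel \<sigma> x y z \<Longrightarrow> rel \<sigma> x' y' z \<Longrightarrow> x = x' \<and> y = y';
    bs \<sigma> a;
    bs \<sigma> b;
    \<And>x t. cod \<sigma> x t \<Longrightarrow> dm \<sigma> x;
    \<And>x t t'. cod \<sigma> x t \<Longrightarrow> cod \<sigma> x t' \<Longrightarrow> t = t';
    \<And>x. dm \<sigma> x \<Longrightarrow> \<not> bs \<sigma> x \<Longrightarrow> \<exists>t. bs \<sigma> t \<and> cod \<sigma> x t;
    \<And>x y t. dm \<sigma> x \<Longrightarrow> dm \<sigma> y \<Longrightarrow> \<not> bs \<sigma> x \<Longrightarrow> \<not> bs \<sigma> y \<Longrightarrow>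
       cod \<sigma> x t \<Longrightarrow> cod \<sigma> y t \<Longrightarrow> x = y\<rbrakk> \<Longrightarrow> good \<sigma>"

lemma
  assumes "good \<sigma>"
  shows pre_in: "pre \<sigma> x I \<Longrightarrow> x \<in>\<^sub>M X"
    and pre_dm: "pre \<sigma> x I \<Longrightarrow> u \<in>\<^sub>M I \<Longrightarrow> dm \<sigma> u"
    and pre_unique: "pre \<sigma> x I \<Longrightarrow> pre \<sigma> x J \<Longrightarrow> I = J"
    and pre_linear: "pre \<sigma> x I \<Longrightarrow> pre \<sigma> y J \<Longrightarrow> x = y \<or> x \<in>\<^sub>M J \<or> y \<in>\<^sub>M I"
    and pre_wf: "x \<in>\<^sub>M Z \<Longrightarrow> dm \<sigma> x \<Longrightarrow>
       \<exists>x I. x \<in>\<^sub>M Z \<and> pre \<sigma> x I \<and> (\<forall>u. u \<in>\<^sub>M I \<longrightarrow> \<not> u \<in>\<^sub>M Z)"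
    and rel_bs: "rel \<sigma> x y z \<Longrightarrow> bs \<sigma> x \<and> bs \<sigma> y \<and> bs \<sigma> z \<and> z \<noteq> a"
    and bs_dm: "bs \<sigma> x \<Longrightarrow> dm \<sigma> x"
    and ex_rel: "bs \<sigma> x \<Longrightarrow> bs \<sigma> y \<Longrightarrow> \<exists>z. rel \<sigma> x y z"
    and rel_unique: "rel \<sigma> x y z \<Longrightarrow> rel \<sigma> x' y' z \<Longrightarrow> x = x' \<and> y = y'"
    and bs_a: "bs \<sigma> a" and bs_b: "bs \<sigma> b"
    and cod_dm: "cod \<sigma> x t \<Longrightarrow> dm \<sigma> x"
    and cod_unique: "cod \<sigma> x t \<Longrightarrow> cod \<sigma> x t' \<Longrightarrow> t = t'"
    and ex_cod: "dm \<sigma> x \<Longrightarrow> \<not> bs \<sigma> x \<Longrightarrow> \<exists>t. bs \<sigma> t \<and> cod \<sigma> x t"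
    and cod_inj: "dm \<sigma> x \<Longrightarrow> dm \<sigma> y \<Longrightarrow> \<not> bs \<sigma> x \<Longrightarrow> \<not> bs \<sigma> y \<Longrightarrow>
       cod \<sigma> x t \<Longrightarrow> cod \<sigma> y t \<Longrightarrow> x = y"
  by (rule good.cases[OF assms], meson bs_def)+

text \<open>\<open>embed\<close> is an injection of \<open>S\<close> into \<open>B\<close>; \<open>a\<close> and \<open>b\<close> serve as tags.\<close>

definition embed :: "'a \<Rightarrow> 'a \<Rightarrow> 'a \<Rightarrow> bool" where
  "embed \<sigma> x w \<longleftrightarrow> bs \<sigma> x \<and> rel \<sigma> a x w \<or> \<not> bs \<sigma> x \<and> (\<exists>t. cod \<sigma> x t \<and> rel \<sigma> b t w)"

definition snoc :: "'a \<Rightarrow> 'a \<Rightarrow> 'a \<Rightarrow> bool" where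
  "snoc s x s' \<longleftrightarrow>
     (\<exists>n. n \<in>\<^sub>M omega \<and> maps s n X \<and> (\<forall>p. p \<in>\<^sub>M s' \<longleftrightarrow> p \<in>\<^sub>M s \<or> p = pair n x))"

text \<open>
  The sequence \<open>s\<close> followed by \<open>x\<close> is coded by the pair of the codes of \<open>s\<close> and \<open>x\<close>. No pair is coded by \<open>a\<close>, which
  is the code of the empty sequence, and so codes are decoded uniquely.
\<close>

definition seq_start :: "'a \<Rightarrow> bool" where "seq_start p \<longleftrightarrow> p = pair emp a"

definition seq_step :: "'a \<Rightarrow> 'a \<Rightarrow> 'a \<Rightarrow> bool" where
  "seq_step \<sigma> p q \<longleftrightarrow> (\<exists>s y x w z s'. x \<in>\<^sub>M X \<and> dm \<sigma> x \<and> embed \<sigma> x w \<and> rel \<sigma> y w z \<and> z \<in>\<^sub>M X \<and>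
     snoc s x s' \<and> p = pair s y \<and> q = pair s' z)"

definition seq_code :: "'a \<Rightarrow> 'a \<Rightarrow> 'a \<Rightarrow> bool" where
  "seq_code \<sigma> s y \<longleftrightarrow> reachable seq_start (seq_step \<sigma>) (pair s y)"

definition diag :: "'a \<Rightarrow> 'a \<Rightarrow> bool" where
  "diag \<sigma> D \<longleftrightarrow> (\<forall>y. y \<in>\<^sub>M D \<longleftrightarrow> y \<in>\<^sub>M X \<and> (\<exists>A s. pair A s \<in>\<^sub>M F \<and> seq_code \<sigma> s y \<and> \<not> y \<in>\<^sub>M A))"

definition fresh :: "'a \<Rightarrow> 'a \<Rightarrow> bool" where
  "fresh \<sigma> g \<longleftrightarrow> (\<exists>D s i n. diag \<sigma> D \<and> pair D s \<in>\<^sub>M F \<and> n \<in>\<^sub>M omega \<and> maps s n X \<and> i \<in>\<^sub>M n \<and>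
     pair i g \<in>\<^sub>M s \<and> \<not> dm \<sigma> g \<and> (\<forall>j u. j \<in>\<^sub>M i \<longrightarrow> pair j u \<in>\<^sub>M s \<longrightarrow> dm \<sigma> u))"

text \<open>
  \<open>full\<close> says that no label is left; then \<open>new_rel\<close> sends the pair of the images of \<open>x\<close> and \<open>y\<close> in \<open>B\<close> to the
  element of \<open>S - B\<close> labelled by its code.
\<close>

definition used :: "'a \<Rightarrow> 'a \<Rightarrow> bool" where
  "used \<sigma> t \<longleftrightarrow> (\<exists>x. dm \<sigma> x \<and> \<not> bs \<sigma> x \<and> cod \<sigma> x t)"

definition next_code :: "'a \<Rightarrow> 'a \<Rightarrow> bool" where
  "next_code \<sigma> t \<longleftrightarrow> bs \<sigma> t \<and> \<not> used \<sigma> t \<and> (\<forall>I u. pre \<sigma> t I \<longrightarrow> u \<in>\<^sub>M I \<longrightarrow> bs \<sigma> u \<longrightarrow> used \<sigma> u)"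

definition full :: "'a \<Rightarrow> bool" where "full \<sigma> \<longleftrightarrow> (\<forall>t. bs \<sigma> t \<longrightarrow> used \<sigma> t)"

definition new_rel :: "'a \<Rightarrow> 'a \<Rightarrow> 'a \<Rightarrow> 'a \<Rightarrow> bool" where
  "new_rel \<sigma> x y z \<longleftrightarrow> full \<sigma> \<and> dm \<sigma> x \<and> dm \<sigma> y \<and> \<not> (bs \<sigma> x \<and> bs \<sigma> y) \<and> dm \<sigma> z \<and> \<not> bs \<sigma> z \<and>
     (\<exists>p q w. embed \<sigma> x p \<and> embed \<sigma> y q \<and> rel \<sigma> p q w \<and> cod \<sigma> z w)"

definition new_pre :: "'a \<Rightarrow> 'a \<Rightarrow> 'a \<Rightarrow> bool" where
  "new_pre \<sigma> x I \<longleftrightarrow> fresh \<sigma> x \<and> (\<exists>t. next_code \<sigma> t) \<and> (\<forall>y. y \<in>\<^sub>M I \<longleftrightarrow> dm \<sigma> y)"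

definition new_cod :: "'a \<Rightarrow> 'a \<Rightarrow> 'a \<Rightarrow> bool" where
  "new_cod \<sigma> x t \<longleftrightarrow> fresh \<sigma> x \<and> next_code \<sigma> t"

text \<open>Together with \<open>base_rel\<close> this is the initial state: the order of
  \<open>omega\<close> and the pairing \<open>code\<close> transported along \<open>e\<close>. All
  of \<open_placeholder>\<close>

definition base_pre :: "'a \<Rightarrow> 'a \<Rightarrow> bool" where
  "base_pre x I \<longleftrightarrow> (\<exists>n. pair n x \<in>\<^sub>M e \<and> (\<forall>y. y \<in>\<^sub>M I \<longleftrightarrow> (\<exists>m. m \<in>\<^sub>M n \<and> pair m y \<in>\<^sub>M e)))"

definition base_rel :: "'a \<Rightarrow> 'a \<Rightarrow> 'a \<Rightarrow> bool" where
  "base_rel x y z \<longleftrightarrow>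
     (\<exists>m n k. code m n k \<and> pair m x \<in>\<^sub>M e \<and> pair n y \<in>\<^sub>M e \<and> pair k z \<in>\<^sub>M e)"

definition extension :: "'a \<Rightarrow> 'a \<Rightarrow> bool" where
  "extension \<sigma> u \<longleftrightarrow>
     (\<exists>x I. u = pair emp (pair x I) \<and> (\<sigma> = emp \<and> base_pre x I \<or> new_pre \<sigma> x I)) \<or>
     (\<exists>x y z. u = pair (succ emp) (pair x (pair y z)) \<and> (\<sigma> = emp \<and> base_rel x y z \<or> new_rel \<sigma> x y z)) \<or>
     (\<exists>x t. u = pair (succ (succ emp)) (pair x t) \<and> new_cod \<sigma> x t)"

definition next_state :: "'a \<Rightarrow> 'a" where
  "next_state \<sigma> = coll (\<lambda>u. u \<in>\<^sub>M U \<and> (u \<in>\<^sub>M \<sigma> \<or> extension \<sigma> u))"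

lemma definable_pre [df]:
  "definable_term s \<Longrightarrow> definable_term t \<Longrightarrow> definable_term u \<Longrightarrow> definable (\<lambda>v. pre (s v) (t v) (u v))"
  unfolding pre_def by (intro df)

lemma definable_rel [df]:
  "definable_term s \<Longrightarrow> definable_term t \<Longrightarrow> definable_term u \<Longrightarrow> definable_term w \<Longrightarrow>
    definable (\<lambda>v. rel (s v) (t v) (u v) (w v))"
  unfolding rel_def by (intro df)

lemma definable_cod [df]:
  "definable_term s \<Longrightarrow> definable_term t \<Longrightarrow> definable_term u \<Longrightarrow> definable (\<lambda>v. cod (s v) (t v) (u v))"
  unfolding cod_def by (intro df)

lemma definable_dm [df]:
  "definable_term s \<Longrightarrow> definable_term t \<Longrightarrow> definable (\<lambda>v. dm (s v) (t v))"
  by (rule definable_comp2[where P = dm]) (unfold dm_def, intro df)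

lemma definable_bs [df]:
  "definable_term s \<Longrightarrow> definable_term t \<Longrightarrow> definable (\<lambda>v. bs (s v) (t v))"
  by (rule definable_comp2[where P = bs]) (unfold bs_def, intro df)

lemma definable_good [df]: "definable_term s \<Longrightarrow> definable (\<lambda>v. good (s v))"
  by (rule definable_comp1[where P = good]) (unfold good.simps, intro df)

lemma definable_embed [df]:
  "definable_term s \<Longrightarrow> definable_term t \<Longrightarrow> definable_term u \<Longrightarrow> definable (\<lambda>v. embed (s v) (t v) (u v))"
  by (rule definable_comp3[where P = embed]) (unfold embed_def, intro df)

lemma definable_snoc [df]:
  "definable_term s \<Longrightarrow> definable_term t \<Longrightarrow> definable_term u \<Longrightarrow> definable (\<lambda>v. snoc (s v) (t v) (u v))"
  by (rule definable_comp3[where P = snoc]) (unfold snoc_def, intro df)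

lemma definable_seq_step [df]:
  "definable_term s \<Longrightarrow> definable_term t \<Longrightarrow> definable_term u \<Longrightarrow>
    definable (\<lambda>v. seq_step (s v) (t v) (u v))"
  by (rule definable_comp3[where P = seq_step]) (unfold seq_step_def, intro df)

lemma definable_seq_code [df]:
  "definable_term s \<Longrightarrow> definable_term t \<Longrightarrow> definable_term u \<Longrightarrow>
    definable (\<lambda>v. seq_code (s v) (t v) (u v))"
  by (rule definable_comp3[where P = seq_code])
    (unfold seq_code_def reachable_def seq_start_def, intro df)

lemma definable_diag [df]:
  "definable_term s \<Longrightarrow> definable_term t \<Longrightarrow> definable (\<lambda>v. diag (s v) (t v))"
  by (rule definable_comp2[where P = diag]) (unfold diag_def, intro df)

lemma definable_fresh [df]:
  "definable_term s \<Longrightarrow> definable_term t \<Longrightarrow> definable (\<lambda>v. fresh (s v) (t v))"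
  by (rule definable_comp2[where P = fresh]) (unfold fresh_def, intro df)

lemma definable_used [df]:
  "definable_term s \<Longrightarrow> definable_term t \<Longrightarrow> definable (\<lambda>v. used (s v) (t v))"
  by (rule definable_comp2[where P = used]) (unfold used_def, intro df)

lemma definable_next_code [df]:
  "definable_term s \<Longrightarrow> definable_term t \<Longrightarrow> definable (\<lambda>v. next_code (s v) (t v))"
  by (rule definable_comp2[where P = next_code]) (unfold next_code_def, intro df)

lemma definable_extension [df]:
  "definable_term s \<Longrightarrow> definable_term t \<Longrightarrow> definable (\<lambda>v. extension (s v) (t v))"
  by (rule definable_comp2[where P = extension])
    (unfold extension_def base_pre_def base_rel_def new_pre_def new_rel_def new_cod_def full_def,
      intro df)

lemma mem_next_state: "u \<in>\<^sub>M next_state \<sigma> \<longleftrightarrow> u \<in>\<^sub>M U \<and> (u \<in>\<^sub>M \<sigma> \<or> extension \<sigma> u)"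
proof -
  have "definable (\<lambda>v. v 0 \<in>\<^sub>M \<sigma> \<or> extension \<sigma> (v 0))" by (intro df)
  from coll_iff[OF ex_sep[of "\<lambda>u. u \<in>\<^sub>M \<sigma> \<or> extension \<sigma> u", OF this]]
  show ?thesis by (simp add: next_state_def)
qed

lemma definable_next_state: "definable (\<lambda>v. v 0 = next_state (v (Suc 0)))"
  unfolding extensionality_iff mem_next_state by (intro df)

lemma mapsI:
  assumes "\<And>p. p \<in>\<^sub>M f \<Longrightarrow> \<exists>x y. x \<in>\<^sub>M A \<and> y \<in>\<^sub>M B \<and> p = pair x y"
    and "\<And>x. x \<in>\<^sub>M A \<Longrightarrow> \<exists>y. pair x y \<in>\<^sub>M f"
    and "\<And>x y z. pair x y \<in>\<^sub>M f \<Longrightarrow> pair x z \<in>\<^sub>M f \<Longrightarrow> y = z"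
  shows "maps f A B"
  using assms unfolding maps_def by blast

lemma maps_memE:
  assumes "maps f A B" "p \<in>\<^sub>M f"
  obtains x y where "x \<in>\<^sub>M A" "y \<in>\<^sub>M B" "p = pair x y"
  using assms unfolding maps_def by blast

lemma maps_pairD: "maps f A B \<Longrightarrow> pair x y \<in>\<^sub>M f \<Longrightarrow> x \<in>\<^sub>M A \<and> y \<in>\<^sub>M B"
  by (erule maps_memE, assumption) (simp add: pair_inject)

lemma maps_ex: "maps f A B \<Longrightarrow> x \<in>\<^sub>M A \<Longrightarrow> \<exists>y. pair x y \<in>\<^sub>M f"
  unfolding maps_def by blast

lemma maps_unique: "maps f A B \<Longrightarrow> pair x y \<in>\<^sub>M f \<Longrightarrow> pair x z \<in>\<^sub>M f \<Longrightarrow> y = z"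
  using maps_pairD[of f A B x y] unfolding maps_def by blast

lemma maps_dom_unique:
  assumes "maps s m A" "maps s n B"
  shows "m = n"
  using maps_ex[OF assms(1)] maps_ex[OF assms(2)] maps_pairD[OF assms(1)] maps_pairD[OF assms(2)]
  by (intro extensionality) blast

lemma injection_maps: "injection f A B \<Longrightarrow> maps f A B"
  by (simp add: injection_def)

lemma injection_inj: "injection f A B \<Longrightarrow> pair x y \<in>\<^sub>M f \<Longrightarrow> pair x' y \<in>\<^sub>M f \<Longrightarrow> x = x'"
  unfolding injection_def by blast

lemmas maps_F = injection_maps[OF injection_F]
lemmas maps_e = injection_maps[OF injection_e]

lemma dm_in: "good \<sigma> \<Longrightarrow> dm \<sigma> x \<Longrightarrow> x \<in>\<^sub>M X"
  unfolding dm_def using pre_in by blast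

lemma a_neq_b: "a \<noteq> b"
  using maps_unique[OF maps_e] a b injection_inj[OF injection_e] by (metis succ_neq_emp(1))

lemma embed_bs: "good \<sigma> \<Longrightarrow> embed \<sigma> x w \<Longrightarrow> bs \<sigma> w"
  unfolding embed_def using rel_bs by blast

lemma ex_embed: "good \<sigma> \<Longrightarrow> dm \<sigma> x \<Longrightarrow> \<exists>w. embed \<sigma> x w"
  unfolding embed_def using ex_rel bs_a bs_b ex_cod by metis

lemma embed_left_unique:
  assumes "good \<sigma>" "dm \<sigma> x" "dm \<sigma> y" "embed \<sigma> x w" "embed \<sigma> y w"
  shows "x = y"
  using assms(4,5) rel_unique[OF assms(1)] cod_inj[OF assms(1-3)] a_neq_b
  unfolding embed_def by metis

lemma seq_system: "set_system seq_start (seq_step \<sigma>)"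
  unfolding set_system_def
proof (intro conjI)
  show "definable (\<lambda>v. seq_start (v 0))" unfolding seq_start_def by (intro df)
  show "definable (\<lambda>v. seq_step \<sigma> (v 0) (v (Suc 0)))" by (intro df)
  obtain V where V: "\<forall>x. x \<in>\<^sub>M V \<longleftrightarrow> x \<in>\<^sub>M finseqs X \<or> x \<in>\<^sub>M X" using ex_bin_union by blast
  obtain W where W: "\<forall>x y. x \<in>\<^sub>M V \<longrightarrow> y \<in>\<^sub>M V \<longrightarrow> x \<in>\<^sub>M W \<and> pair x y \<in>\<^sub>M W" using pair_bound by blast
  have "maps emp emp X" by (simp add: maps_def)
  then have "emp \<in>\<^sub>M finseqs X" using mem_finseqs_iff mem_funs_iff emp_in_omega by blast
  moreover have "a \<in>\<^sub>M X" using a maps_pairD[OF maps_e] by blast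
  moreover have "s' \<in>\<^sub>M finseqs X" if "snoc s x s'" "x \<in>\<^sub>M X" for s x s'
  proof -
    from that(1) obtain n where n: "n \<in>\<^sub>M omega" "maps s n X"
      and s': "\<And>p. p \<in>\<^sub>M s' \<longleftrightarrow> p \<in>\<^sub>M s \<or> p = pair n x"
      unfolding snoc_def by blast
    have no: "\<not> pair n y \<in>\<^sub>M s" for y
      using maps_pairD[OF n(2)] not_mem_self[of n] by blast
    have "maps s' (succ n) X"
    proof (rule mapsI)
      fix p assume "p \<in>\<^sub>M s'"
      then show "\<exists>x y. x \<in>\<^sub>M succ n \<and> y \<in>\<^sub>M X \<and> p = pair x y"
        using s' that(2) maps_memE[OF n(2), of p] mem_succ by metis
    next
      fix i assume "i \<in>\<^sub>M succ n"
      then show "\<exists>y. pair i y \<in>\<^sub>M s'" using s' maps_ex[OF n(2)] by auto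
    next
      fix i y z assume "pair i y \<in>\<^sub>M s'" "pair i z \<in>\<^sub>M s'"
      then show "y = z" using s' no maps_unique[OF n(2)] by (auto simp: pair_inject)
    qed
    then show ?thesis using mem_finseqs_iff mem_funs_iff n(1) succ_in_omega by blast
  qed
  ultimately show "\<exists>W. (\<forall>x. seq_start x \<longrightarrow> x \<in>\<^sub>M W) \<and> (\<forall>x y. x \<in>\<^sub>M W \<longrightarrow> seq_step \<sigma> x y \<longrightarrow> y \<in>\<^sub>M W)"
    unfolding seq_start_def seq_step_def using V W by (intro exI[of _ W]) blast
qed

lemma seq_code_left_unique:
  assumes good: "good \<sigma>" and "seq_code \<sigma> s y" "seq_code \<sigma> s' y"
  shows "s = s'"
  using assms(2,3) unfolding seq_code_def
proof (rule reachable_left_unique[OF seq_system, rotated -2])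
  show "seq_start (pair s y) \<Longrightarrow> seq_start (pair s' y) \<Longrightarrow> s = s'" for s s' y
    by (simp add: seq_start_def pair_inject)
  show "seq_step \<sigma> p (pair s' y) \<Longrightarrow> False" if "seq_start (pair s y)" for s s' y p
    using that rel_bs[OF good] unfolding seq_start_def seq_step_def pair_inject by blast
  show "y = y' \<and> (s = s' \<longrightarrow> t = t')"
    if 1: "seq_step \<sigma> (pair s y) (pair t z)" and 2: "seq_step \<sigma> (pair s' y') (pair t' z)"
    for s y t z s' y' t'
  proof -
    obtain x w where x: "dm \<sigma> x" "embed \<sigma> x w" "rel \<sigma> y w z" "snoc s x t"
      using 1 unfolding seq_step_def pair_inject by blast
    obtain x' w' where x': "dm \<sigma> x'" "embed \<sigma> x' w'" "rel \<sigma> y' w' z" "snoc s' x' t'"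
      using 2 unfolding seq_step_def pair_inject by blast
    have "y = y'" "w = w'" using rel_unique[OF good x(3) x'(3)] by auto
    then have "x = x'" using embed_left_unique[OF good] x x' by blast
    have "t = t'" if "s = s'"
    proof (rule extensionality)
      obtain n where n: "maps s n X" "\<forall>p. p \<in>\<^sub>M t \<longleftrightarrow> p \<in>\<^sub>M s \<or> p = pair n x"
        using x(4) unfolding snoc_def by blast
      obtain n' where n': "maps s n' X" "\<forall>p. p \<in>\<^sub>M t' \<longleftrightarrow> p \<in>\<^sub>M s \<or> p = pair n' x"
        using x'(4) \<open>s = s'\<close> \<open>x = x'\<close> unfolding snoc_def by blast
      have "n = n'" using n(1) n'(1) by (rule maps_dom_unique)
      then show "\<forall>p. p \<in>\<^sub>M t \<longleftrightarrow> p \<in>\<^sub>M t'" using n(2) n'(2) by blast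
    qed
    then show ?thesis using \<open>y = y'\<close> by blast
  qed
qed (auto simp: seq_start_def seq_step_def)

lemma seq_code_bs:
  assumes "good \<sigma>" "seq_code \<sigma> s y"
  shows "bs \<sigma> y"
  using reachable_cases[OF seq_system assms(2)[unfolded seq_code_def]] bs_a rel_bs assms(1)
  unfolding seq_start_def seq_step_def pair_inject by blast

lemma ex_seq_code:
  assumes good: "good \<sigma>" and "n \<in>\<^sub>M omega"
  shows "\<forall>s. maps s n X \<longrightarrow> (\<forall>i x. pair i x \<in>\<^sub>M s \<longrightarrow> dm \<sigma> x) \<longrightarrow> (\<exists>y. seq_code \<sigma> s y)"
  using assms(2)
proof (induction n rule: omega_induct)
  case definable
  show ?case by (intro df)
next
  case zero
  have "s = emp" if "maps s emp X" for s
    using that by (intro emp_eqI) (auto elim: maps_memE)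
  then show ?case
    using reachable_start[of seq_start] unfolding seq_code_def seq_start_def by blast
next
  case (succ n)
  show ?case
  proof (intro allI impI)
    fix s assume s: "maps s (succ n) X" "\<forall>i x. pair i x \<in>\<^sub>M s \<longrightarrow> dm \<sigma> x"
    obtain x where x: "pair n x \<in>\<^sub>M s" using maps_ex[OF s(1), of n] by auto
    have "definable (\<lambda>v. v 0 \<noteq> pair n x)" by (intro df)
    then obtain r where r: "\<forall>p. p \<in>\<^sub>M r \<longleftrightarrow> p \<in>\<^sub>M s \<and> p \<noteq> pair n x"
      using ex_sep[of "\<lambda>p. p \<noteq> pair n x"] by blast
    have "maps r n X"
    proof (rule mapsI)
      fix p assume p: "p \<in>\<^sub>M r"
      then obtain i y where "i \<in>\<^sub>M succ n" "y \<in>\<^sub>M X" "p = pair i y"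
        using r s(1) by (blast elim: maps_memE)
      then show "\<exists>x y. x \<in>\<^sub>M n \<and> y \<in>\<^sub>M X \<and> p = pair x y"
        using p r maps_unique[OF s(1) x] by auto
    next
      fix i assume i: "i \<in>\<^sub>M n"
      then obtain y where "pair i y \<in>\<^sub>M s" using maps_ex[OF s(1), of i] by auto
      then show "\<exists>y. pair i y \<in>\<^sub>M r"
        using r i not_mem_self[of n] by (auto simp: pair_inject)
    next
      fix i y z assume "pair i y \<in>\<^sub>M r" "pair i z \<in>\<^sub>M r"
      then show "y = z" using r maps_unique[OF s(1)] by blast
    qed
    moreover from this obtain y where y: "seq_code \<sigma> r y"
      using succ.IH s(2) r by blast
    moreover have dmx: "dm \<sigma> x" using s(2) x by blast
    moreover obtain w where w: "embed \<sigma> x w" using ex_embed[OF good dmx] by blast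
    moreover obtain z where z: "rel \<sigma> y w z"
      using ex_rel[OF good] seq_code_bs[OF good y] embed_bs[OF good w] by blast
    moreover have "snoc r x s"
      unfolding snoc_def using succ.hyps \<open>maps r n X\<close> r x by blast
    moreover have "x \<in>\<^sub>M X" "z \<in>\<^sub>M X"
      using dm_in[OF good] dmx rel_bs[OF good z] bs_dm[OF good] by blast+
    ultimately have "seq_step \<sigma> (pair r y) (pair s z)" unfolding seq_step_def by blast
    then show "\<exists>y. seq_code \<sigma> s y"
      using y reachable_step unfolding seq_code_def by metis
  qed
qed

lemma ex_fresh:
  assumes good: "good \<sigma>"
  shows "\<exists>g. fresh \<sigma> g"
proof -
  have "definable (\<lambda>v. \<exists>A s. pair A s \<in>\<^sub>M F \<and> seq_code \<sigma> s (v 0) \<and> \<not> v 0 \<in>\<^sub>M A)" by (intro df)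
  then obtain D where D: "diag \<sigma> D"
    unfolding diag_def using ex_sep[of "\<lambda>y. \<exists>A s. pair A s \<in>\<^sub>M F \<and> seq_code \<sigma> s y \<and> \<not> y \<in>\<^sub>M A"] by blast
  then have "D \<in>\<^sub>M pow X" by (auto simp: diag_def mem_pow_iff subset_of_def)
  then obtain s where s: "pair D s \<in>\<^sub>M F" "s \<in>\<^sub>M finseqs X"
    using maps_ex[OF maps_F] maps_pairD[OF maps_F] by blast
  then obtain n where n: "n \<in>\<^sub>M omega" "maps s n X" unfolding mem_finseqs_iff mem_funs_iff by blast
  have "\<not> seq_code \<sigma> s y" for y
  proof
    assume y: "seq_code \<sigma> s y"
    then have yX: "y \<in>\<^sub>M X" using seq_code_bs[OF good] bs_dm[OF good] dm_in[OF good] by blast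
    show False
    proof (cases "y \<in>\<^sub>M D")
      case True
      then obtain A s' where A: "pair A s' \<in>\<^sub>M F" "seq_code \<sigma> s' y" "\<not> y \<in>\<^sub>M A"
        using D unfolding diag_def by blast
      have "A = D"
        using seq_code_left_unique[OF good A(2) y] A(1) s(1) injection_inj[OF injection_F] by blast
      then show False using A(3) True by blast
    next
      case False
      then show False using D yX y s(1) unfolding diag_def by blast
    qed
  qed
  then obtain i x where ix: "pair i x \<in>\<^sub>M s" "\<not> dm \<sigma> x" using ex_seq_code[OF good n(1)] n(2) by blast
  then have "i \<in>\<^sub>M n" using maps_pairD[OF n(2)] by blast
  moreover have "definable (\<lambda>v. \<exists>x. pair (v 0) x \<in>\<^sub>M s \<and> \<not> dm \<sigma> x)" by (intro df)
  ultimately obtain k where k: "k \<in>\<^sub>M n" "\<exists>x. pair k x \<in>\<^sub>M s \<and> \<not> dm \<sigma> x"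
    "\<forall>j. j \<in>\<^sub>M k \<longrightarrow> j \<in>\<^sub>M n \<longrightarrow> \<not> (\<exists>x. pair j x \<in>\<^sub>M s \<and> \<not> dm \<sigma> x)"
    using ex_minimal[of "\<lambda>k. \<exists>x. pair k x \<in>\<^sub>M s \<and> \<not> dm \<sigma> x" i n] ix by blast
  then obtain g where g: "pair k g \<in>\<^sub>M s" "\<not> dm \<sigma> g" by blast
  have "j \<in>\<^sub>M n" if "pair j u \<in>\<^sub>M s" for j u
    using that maps_pairD[OF n(2)] by blast
  then show ?thesis
    unfolding fresh_def using D s(1) n k(1,3) g by blast
qed

lemma fresh_unique:
  assumes "fresh \<sigma> g" "fresh \<sigma> h"
  shows "g = h"
proof -
  obtain D s i n where g: "diag \<sigma> D" "pair D s \<in>\<^sub>M F" "n \<in>\<^sub>M omega" "maps s n X" "i \<in>\<^sub>M n"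
     "pair i g \<in>\<^sub>M s" "\<not> dm \<sigma> g" "\<forall>j u. j \<in>\<^sub>M i \<longrightarrow> pair j u \<in>\<^sub>M s \<longrightarrow> dm \<sigma> u"
    using assms(1) unfolding fresh_def by blast
  obtain D' s' i' n' where h: "diag \<sigma> D'" "pair D' s' \<in>\<^sub>M F" "n' \<in>\<^sub>M omega" "maps s' n' X" "i' \<in>\<^sub>M n'"
     "pair i' h \<in>\<^sub>M s'" "\<not> dm \<sigma> h" "\<forall>j u. j \<in>\<^sub>M i' \<longrightarrow> pair j u \<in>\<^sub>M s' \<longrightarrow> dm \<sigma> u"
    using assms(2) unfolding fresh_def by blast
  have "D = D'" using g(1) h(1) unfolding diag_def by (intro extensionality) blast
  then have s: "s = s'" using g(2) h(2) maps_unique[OF maps_F] by blast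
  then have "n = n'" using g(4) h(4) maps_dom_unique by blast
  then have "i = i' \<or> i \<in>\<^sub>M i' \<or> i' \<in>\<^sub>M i"
    using omega_linear omega_trans g(3,5) h(5) by metis
  then have "i = i'" using g(6-8) h(6-8) s by blast
  then show ?thesis using maps_unique[OF g(4)] g(6) h(6) s by blast
qed

lemma fresh_in: "fresh \<sigma> g \<Longrightarrow> g \<in>\<^sub>M X \<and> \<not> dm \<sigma> g"
  unfolding fresh_def using maps_pairD by blast

lemma ex_next_code:
  assumes good: "good \<sigma>" and "\<not> full \<sigma>"
  shows "\<exists>t. next_code \<sigma> t"
proof -
  have "definable (\<lambda>v. bs \<sigma> (v 0) \<and> \<not> used \<sigma> (v 0))" by (intro df)
  then obtain Z where Z: "\<forall>t. t \<in>\<^sub>M Z \<longleftrightarrow> t \<in>\<^sub>M X \<and> bs \<sigma> t \<and> \<not> used \<sigma> t"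
    using ex_sep[of "\<lambda>t. bs \<sigma> t \<and> \<not> used \<sigma> t"] by blast
  obtain t where "bs \<sigma> t" "\<not> used \<sigma> t" using assms(2) unfolding full_def by blast
  then have "t \<in>\<^sub>M Z" "dm \<sigma> t" using Z bs_dm[OF good] dm_in[OF good] by auto
  from pre_wf[OF good this] obtain x I where
    "x \<in>\<^sub>M Z" "pre \<sigma> x I" "\<forall>u. u \<in>\<^sub>M I \<longrightarrow> \<not> u \<in>\<^sub>M Z" by blast
  then show ?thesis
    unfolding next_code_def using Z pre_unique[OF good] bs_dm[OF good] dm_in[OF good] by metis
qed

lemma next_code_unique:
  assumes good: "good \<sigma>" and "next_code \<sigma> t" "next_code \<sigma> u"
  shows "t = u"
  using assms(2,3) pre_linear[OF good] bs_dm[OF good] unfolding next_code_def dm_def by metis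

lemma not_next_code_full: "full \<sigma> \<Longrightarrow> \<not> next_code \<sigma> t"
  unfolding full_def next_code_def by blast

lemma extension_pre:
  "extension \<sigma> (pair emp (pair x I)) \<longleftrightarrow> \<sigma> = emp \<and> base_pre x I \<or> new_pre \<sigma> x I"
  unfolding extension_def pair_inject by auto

lemma extension_rel:
  "extension \<sigma> (pair (succ emp) (pair x (pair y z))) \<longleftrightarrow> \<sigma> = emp \<and> base_rel x y z \<or> new_rel \<sigma> x y z"
  unfolding extension_def pair_inject by auto

lemma extension_cod:
  "extension \<sigma> (pair (succ (succ emp)) (pair x t)) \<longleftrightarrow> new_cod \<sigma> x t"
  unfolding extension_def pair_inject by auto

lemma good_neq_emp: "good \<sigma> \<Longrightarrow> \<sigma> \<noteq> emp"
  using bs_a unfolding bs_def rel_def by force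

lemma ex_dm_set:
  assumes good: "good \<sigma>"
  obtains I where "\<And>y. y \<in>\<^sub>M I \<longleftrightarrow> dm \<sigma> y" "subset_of I X"
proof -
  have "definable (\<lambda>v. dm \<sigma> (v 0))" by (intro df)
  then obtain I where "\<forall>y. y \<in>\<^sub>M I \<longleftrightarrow> y \<in>\<^sub>M X \<and> dm \<sigma> y" using ex_sep[of "dm \<sigma>"] by blast
  then show ?thesis using that[of I] dm_in[OF good] by (auto simp: subset_of_def)
qed

context
  fixes \<sigma>
  assumes good: "good \<sigma>" and sub: "subset_of \<sigma> U"
begin

lemma next_pre: "pre (next_state \<sigma>) x I \<longleftrightarrow> pre \<sigma> x I \<or> new_pre \<sigma> x I"
proof -
  have "new_pre \<sigma> x I \<Longrightarrow> pair emp (pair x I) \<in>\<^sub>M U"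
    unfolding new_pre_def using dm_in[OF good] fresh_in by (intro U_pre) (auto simp: subset_of_def)
  then show ?thesis
    using sub good_neq_emp[OF good] unfolding pre_def mem_next_state extension_pre subset_of_def by blast
qed

lemma next_rel: "rel (next_state \<sigma>) x y z \<longleftrightarrow> rel \<sigma> x y z \<or> new_rel \<sigma> x y z"
proof -
  have "new_rel \<sigma> x y z \<Longrightarrow> pair (succ emp) (pair x (pair y z)) \<in>\<^sub>M U"
    unfolding new_rel_def using dm_in[OF good] by (intro U_rel) auto
  then show ?thesis
    using sub good_neq_emp[OF good] unfolding rel_def mem_next_state extension_rel subset_of_def by blast
qed

lemma next_cod: "cod (next_state \<sigma>) x t \<longleftrightarrow> cod \<sigma> x t \<or> new_cod \<sigma> x t"
proof -
  have "new_cod \<sigma> x t \<Longrightarrow> pair (succ (succ emp)) (pair x t) \<in>\<^sub>M U"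
    unfolding new_cod_def next_code_def using dm_in[OF good] bs_dm[OF good] fresh_in
    by (intro U_cod) auto
  then show ?thesis
    using sub unfolding cod_def mem_next_state extension_cod subset_of_def by blast
qed

lemma good_next_full:
  assumes full: "full \<sigma>"
  shows "good (next_state \<sigma>)"
proof -
  let ?\<tau> = "next_state \<sigma>"
  have pre: "pre ?\<tau> = pre \<sigma>" and cod: "cod ?\<tau> = cod \<sigma>"
    using not_next_code_full[OF full] by (auto simp: fun_eq_iff next_pre next_cod new_pre_def new_cod_def)
  then have dm: "dm ?\<tau> = dm \<sigma>" by (simp add: fun_eq_iff dm_def)
  have total: "\<exists>z. rel ?\<tau> x y z" if xy: "dm \<sigma> x" "dm \<sigma> y" for x y
  proof (cases "bs \<sigma> x \<and> bs \<sigma> y")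
    case True
    then show ?thesis using ex_rel[OF good] next_rel by blast
  next
    case False
    obtain p q where pq: "embed \<sigma> x p" "embed \<sigma> y q" using xy ex_embed[OF good] by blast
    then obtain w where w: "rel \<sigma> p q w" using ex_rel[OF good] embed_bs[OF good] by blast
    then obtain z where "dm \<sigma> z" "\<not> bs \<sigma> z" "cod \<sigma> z w"
      using full rel_bs[OF good] unfolding full_def used_def by blast
    then show ?thesis using full False xy pq w next_rel unfolding new_rel_def by blast
  qed
  have bs: "bs ?\<tau> x \<longleftrightarrow> dm \<sigma> x" for x
  proof
    assume "bs ?\<tau> x"
    then show "dm \<sigma> x"
      using next_rel rel_bs[OF good] bs_dm[OF good] unfolding bs_def[of ?\<tau>] new_rel_def by blast
  next
    assume "dm \<sigma> x"
    then show "bs ?\<tau> x" using total unfolding bs_def[of ?\<tau>] by blast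
  qed
  show ?thesis
  proof (rule goodI)
    fix x y z assume "rel ?\<tau> x y z"
    then show "bs ?\<tau> y \<and> bs ?\<tau> z \<and> z \<noteq> a"
      using rel_bs[OF good] bs_dm[OF good] bs_a[OF good] bs unfolding next_rel new_rel_def by blast
  next
    fix x y x' y' z assume 1: "rel ?\<tau> x y z" and 2: "rel ?\<tau> x' y' z"
    show "x = x' \<and> y = y'"
    proof (cases "bs \<sigma> z")
      case True
      then have "rel \<sigma> x y z" "rel \<sigma> x' y' z"
        using 1 2 unfolding next_rel new_rel_def by auto
      then show ?thesis by (rule rel_unique[OF good])
    next
      case False
      then have "new_rel \<sigma> x y z" "new_rel \<sigma> x' y' z"
        using 1 2 rel_bs[OF good] unfolding next_rel by blast+
      then obtain p q w p' q' w' where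
        *: "embed \<sigma> x p" "embed \<sigma> y q" "rel \<sigma> p q w" "cod \<sigma> z w"
        "embed \<sigma> x' p'" "embed \<sigma> y' q'" "rel \<sigma> p' q' w'" "cod \<sigma> z w'"
        and d: "dm \<sigma> x" "dm \<sigma> y" "dm \<sigma> x'" "dm \<sigma> y'"
        unfolding new_rel_def by blast
      have "w = w'" using * cod_unique[OF good] by blast
      then have "p = p'" "q = q'" using * rel_unique[OF good] by blast+
      then show ?thesis using * d embed_left_unique[OF good] by blast
    qed
  next
    fix x I assume "pre ?\<tau> x I"
    then show "x \<in>\<^sub>M X" unfolding pre by (rule pre_in[OF good])
  next
    fix x I u assume "pre ?\<tau> x I" "u \<in>\<^sub>M I"
    then show "dm ?\<tau> u" unfolding pre dm by (rule pre_dm[OF good])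
  next
    fix x I J assume "pre ?\<tau> x I" "pre ?\<tau> x J"
    then show "I = J" unfolding pre by (rule pre_unique[OF good])
  next
    fix x y I J assume "pre ?\<tau> x I" "pre ?\<tau> y J"
    then show "x = y \<or> x \<in>\<^sub>M J \<or> y \<in>\<^sub>M I" unfolding pre by (rule pre_linear[OF good])
  next
    fix Z x assume "x \<in>\<^sub>M Z" "dm ?\<tau> x"
    then show "\<exists>x I. x \<in>\<^sub>M Z \<and> pre ?\<tau> x I \<and> (\<forall>u. u \<in>\<^sub>M I \<longrightarrow> \<not> u \<in>\<^sub>M Z)"
      unfolding pre dm by (rule pre_wf[OF good])
  next
    fix x t assume "cod ?\<tau> x t"
    then show "dm ?\<tau> x" unfolding cod dm by (rule cod_dm[OF good])
  next
    fix x t t' assume "cod ?\<tau> x t" "cod ?\<tau> x t'"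
    then show "t = t'" unfolding cod by (rule cod_unique[OF good])
  qed (use total bs dm bs_a[OF good] bs_b[OF good] bs_dm[OF good] in auto)
qed

lemma good_next_not_full:
  assumes nfull: "\<not> full \<sigma>"
  shows "good (next_state \<sigma>)"
proof -
  let ?\<tau> = "next_state \<sigma>"
  obtain g where g: "fresh \<sigma> g" using ex_fresh[OF good] by blast
  obtain c where c: "next_code \<sigma> c" using ex_next_code[OF good nfull] by blast
  obtain S where S: "\<And>y. y \<in>\<^sub>M S \<longleftrightarrow> dm \<sigma> y" "subset_of S X" using ex_dm_set[OF good] by blast
  have gX: "g \<in>\<^sub>M X" and gS: "\<not> dm \<sigma> g" using fresh_in[OF g] by auto
  have rel: "rel ?\<tau> = rel \<sigma>" using nfull by (auto simp: fun_eq_iff next_rel new_rel_def)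
  then have bs: "bs ?\<tau> = bs \<sigma>" by (simp add: fun_eq_iff bs_def)
  have pre: "pre ?\<tau> x I \<longleftrightarrow> pre \<sigma> x I \<or> x = g \<and> I = S" for x I
    using fresh_unique[OF g] g c S extensionality[of I S] unfolding next_pre new_pre_def by blast
  have cod: "cod ?\<tau> x t \<longleftrightarrow> cod \<sigma> x t \<or> x = g \<and> t = c" for x t
    using fresh_unique[OF g] g c next_code_unique[OF good c] unfolding next_cod new_cod_def by blast
  have dm: "dm ?\<tau> x \<longleftrightarrow> dm \<sigma> x \<or> x = g" for x
    unfolding dm_def pre by blast
  have preg: "\<not> pre \<sigma> g I" and codg: "\<not> cod \<sigma> g t" for I t
    using gS cod_dm[OF good] unfolding dm_def by blast+
  have bsc: "bs \<sigma> c" and usedc: "\<not> used \<sigma> c" using c unfolding next_code_def by auto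
  show ?thesis
  proof (rule goodI)
    fix x I assume "pre ?\<tau> x I"
    then show "x \<in>\<^sub>M X" unfolding pre using gX pre_in[OF good] by blast
  next
    fix x I u assume "pre ?\<tau> x I" "u \<in>\<^sub>M I"
    then show "dm ?\<tau> u" unfolding pre dm using S(1) pre_dm[OF good] by blast
  next
    fix x I J assume "pre ?\<tau> x I" "pre ?\<tau> x J"
    then show "I = J" unfolding pre using preg pre_unique[OF good] by blast
  next
    fix x y I J assume 1: "pre ?\<tau> x I" "pre ?\<tau> y J"
    have "pre \<sigma> z K \<Longrightarrow> z \<in>\<^sub>M S" for z K using S(1) unfolding dm_def by blast
    then show "x = y \<or> x \<in>\<^sub>M J \<or> y \<in>\<^sub>M I"
      using 1 pre_linear[OF good, of x I y J] unfolding pre by blast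
  next
    fix Z x assume x: "x \<in>\<^sub>M Z" "dm ?\<tau> x"
    show "\<exists>x I. x \<in>\<^sub>M Z \<and> pre ?\<tau> x I \<and> (\<forall>u. u \<in>\<^sub>M I \<longrightarrow> \<not> u \<in>\<^sub>M Z)"
    proof (cases "\<exists>y. y \<in>\<^sub>M Z \<and> dm \<sigma> y")
      case True
      then show ?thesis using pre_wf[OF good] unfolding pre by blast
    next
      case False
      then show ?thesis using x S(1) unfolding pre dm by blast
    qed
  next
    fix x y z assume "rel ?\<tau> x y z"
    then show "bs ?\<tau> y \<and> bs ?\<tau> z \<and> z \<noteq> a" unfolding rel bs using rel_bs[OF good] by blast
  next
    fix x assume "bs ?\<tau> x"
    then show "dm ?\<tau> x" unfolding bs dm using bs_dm[OF good] by blast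
  next
    fix x y assume "bs ?\<tau> x" "bs ?\<tau> y"
    then show "\<exists>z. rel ?\<tau> x y z" unfolding rel bs by (rule ex_rel[OF good])
  next
    fix x y x' y' z assume "rel ?\<tau> x y z" "rel ?\<tau> x' y' z"
    then show "x = x' \<and> y = y'" unfolding rel by (rule rel_unique[OF good])
  next
    show "bs ?\<tau> a" "bs ?\<tau> b" unfolding bs using bs_a bs_b good by auto
  next
    fix x t assume "cod ?\<tau> x t"
    then show "dm ?\<tau> x" unfolding cod dm using cod_dm[OF good] by blast
  next
    fix x t t' assume "cod ?\<tau> x t" "cod ?\<tau> x t'"
    then show "t = t'" unfolding cod using cod_unique[OF good] codg by blast
  next
    fix x assume "dm ?\<tau> x" "\<not> bs ?\<tau> x"
    then show "\<exists>t. bs ?\<tau> t \<and> cod ?\<tau> x t"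
      unfolding bs cod dm using ex_cod[OF good] bsc by blast
  next
    fix x y t
    assume "dm ?\<tau> x" "dm ?\<tau> y" "\<not> bs ?\<tau> x" "\<not> bs ?\<tau> y" "cod ?\<tau> x t" "cod ?\<tau> y t"
    then show "x = y"
      unfolding bs cod dm using cod_inj[OF good] usedc codg unfolding used_def by blast
  qed
qed

lemma good_next: "good (next_state \<sigma>)"
  using good_next_full good_next_not_full by blast

lemma next_neq: "next_state \<sigma> \<noteq> \<sigma>"
proof
  assume fixed: "next_state \<sigma> = \<sigma>"
  show False
  proof (cases "full \<sigma>")
    case True
    then obtain x where x: "dm \<sigma> x" "\<not> bs \<sigma> x"
      using bs_a[OF good] unfolding full_def used_def by blast
    obtain p where p: "embed \<sigma> x p" using ex_embed[OF good x(1)] by blast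
    then obtain w where w: "rel \<sigma> p p w" using ex_rel[OF good] embed_bs[OF good] by blast
    then obtain z where "dm \<sigma> z" "\<not> bs \<sigma> z" "cod \<sigma> z w"
      using True rel_bs[OF good] unfolding full_def used_def by blast
    then have "rel (next_state \<sigma>) x x z"
      using True x p w unfolding next_rel new_rel_def by blast
    then show False using x(2) unfolding fixed bs_def by blast
  next
    case False
    obtain g where g: "fresh \<sigma> g" using ex_fresh[OF good] by blast
    obtain I where "\<And>y. y \<in>\<^sub>M I \<longleftrightarrow> dm \<sigma> y" using ex_dm_set[OF good] by blast
    then have "pre (next_state \<sigma>) g I"
      using g ex_next_code[OF good False] unfolding next_pre new_pre_def by blast
    then show False using fresh_in[OF g] unfolding fixed dm_def by blast
  qed
qed

end

lemma emp_state: "\<not> pre emp x I" "\<not> rel emp x y z" "\<not> cod emp x t" "\<not> dm emp x" "\<not> bs emp x"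
  by (auto simp: pre_def rel_def cod_def dm_def bs_def)

lemma base_pre_iff: "pre (next_state emp) x I \<longleftrightarrow> base_pre x I"
proof -
  have "\<not> new_pre emp x I" by (simp add: new_pre_def next_code_def emp_state)
  moreover have "pair emp (pair x I) \<in>\<^sub>M U" if "base_pre x I"
    using that maps_pairD[OF maps_e] unfolding base_pre_def by (intro U_pre) (auto simp: subset_of_def)
  ultimately show ?thesis
    unfolding pre_def mem_next_state extension_pre by auto
qed

lemma base_rel_iff: "rel (next_state emp) x y z \<longleftrightarrow> base_rel x y z"
proof -
  have "\<not> new_rel emp x y z" by (simp add: new_rel_def emp_state)
  moreover have "pair (succ emp) (pair x (pair y z)) \<in>\<^sub>M U" if "base_rel x y z"
    using that maps_pairD[OF maps_e] unfolding base_rel_def by (intro U_rel) auto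
  ultimately show ?thesis
    unfolding rel_def mem_next_state extension_rel by auto
qed

lemma base_cod_iff: "\<not> cod (next_state emp) x t"
  unfolding cod_def mem_next_state extension_cod by (simp add: new_cod_def next_code_def emp_state)

lemma base_dm_iff: "dm (next_state emp) x \<longleftrightarrow> (\<exists>n. pair n x \<in>\<^sub>M e)"
proof -
  have "\<exists>I. \<forall>y. y \<in>\<^sub>M I \<longleftrightarrow> (\<exists>m. m \<in>\<^sub>M n \<and> pair m y \<in>\<^sub>M e)" for n
  proof -
    have "definable (\<lambda>v. \<exists>m. m \<in>\<^sub>M n \<and> pair m (v 0) \<in>\<^sub>M e)" by (intro df)
    then obtain I where "\<forall>y. y \<in>\<^sub>M I \<longleftrightarrow> y \<in>\<^sub>M X \<and> (\<exists>m. m \<in>\<^sub>M n \<and> pair m y \<in>\<^sub>M e)"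
      using ex_sep[of "\<lambda>y. \<exists>m. m \<in>\<^sub>M n \<and> pair m y \<in>\<^sub>M e"] by blast
    then show ?thesis using maps_pairD[OF maps_e] by blast
  qed
  then show ?thesis unfolding dm_def base_pre_iff base_pre_def by blast
qed

lemma base_rel_ex:
  assumes "pair m x \<in>\<^sub>M e" "pair n y \<in>\<^sub>M e"
  shows "\<exists>z. rel (next_state emp) x y z"
proof -
  have "m \<in>\<^sub>M omega" "n \<in>\<^sub>M omega" using assms maps_pairD[OF maps_e] by blast+
  then obtain k where k: "code m n k" using ex_code by blast
  then obtain z where "pair k z \<in>\<^sub>M e" using maps_ex[OF maps_e] code_in_omega by blast
  then show ?thesis using k assms unfolding base_rel_iff base_rel_def by blast
qed

lemma base_bs_iff: "bs (next_state emp) x \<longleftrightarrow> (\<exists>n. pair n x \<in>\<^sub>M e)"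
proof
  assume "bs (next_state emp) x"
  then show "\<exists>n. pair n x \<in>\<^sub>M e" unfolding bs_def base_rel_iff base_rel_def by blast
next
  assume "\<exists>n. pair n x \<in>\<^sub>M e"
  then show "bs (next_state emp) x" unfolding bs_def using base_rel_ex a by blast
qed

lemma good_base: "good (next_state emp)"
proof (rule goodI)
  fix x I assume "pre (next_state emp) x I"
  then show "x \<in>\<^sub>M X" using maps_pairD[OF maps_e] unfolding base_pre_iff base_pre_def by blast
next
  fix x I u assume "pre (next_state emp) x I" "u \<in>\<^sub>M I"
  then show "dm (next_state emp) u" unfolding base_pre_iff base_dm_iff base_pre_def by blast
next
  fix x I J assume "pre (next_state emp) x I" "pre (next_state emp) x J"
  then show "I = J" using injection_inj[OF injection_e] extensionality[of I J]
    unfolding base_pre_iff base_pre_def by metis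
next
  fix x y I J assume "pre (next_state emp) x I" "pre (next_state emp) y J"
  then obtain m n where mn: "pair m x \<in>\<^sub>M e" "pair n y \<in>\<^sub>M e"
    and IJ: "\<And>z. z \<in>\<^sub>M I \<longleftrightarrow> (\<exists>k. k \<in>\<^sub>M m \<and> pair k z \<in>\<^sub>M e)" "\<And>z. z \<in>\<^sub>M J \<longleftrightarrow> (\<exists>k. k \<in>\<^sub>M n \<and> pair k z \<in>\<^sub>M e)"
    unfolding base_pre_iff base_pre_def by blast
  have "m = n \<or> m \<in>\<^sub>M n \<or> n \<in>\<^sub>M m" using omega_linear maps_pairD[OF maps_e] mn by blast
  then show "x = y \<or> x \<in>\<^sub>M J \<or> y \<in>\<^sub>M I" using mn IJ maps_unique[OF maps_e] by blast
next
  fix Z x assume x: "x \<in>\<^sub>M Z" "dm (next_state emp) x"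
  then obtain n where n: "pair n x \<in>\<^sub>M e" unfolding base_dm_iff by blast
  have "definable (\<lambda>v. \<exists>y. y \<in>\<^sub>M Z \<and> pair (v 0) y \<in>\<^sub>M e)" by (intro df)
  then obtain m where m: "\<exists>y. y \<in>\<^sub>M Z \<and> pair m y \<in>\<^sub>M e"
    "\<forall>k. k \<in>\<^sub>M m \<longrightarrow> k \<in>\<^sub>M omega \<longrightarrow> \<not> (\<exists>y. y \<in>\<^sub>M Z \<and> pair k y \<in>\<^sub>M e)"
    using ex_minimal[of "\<lambda>m. \<exists>y. y \<in>\<^sub>M Z \<and> pair m y \<in>\<^sub>M e" n omega] x n maps_pairD[OF maps_e] by blast
  then obtain y where y: "y \<in>\<^sub>M Z" "pair m y \<in>\<^sub>M e" by blast
  then obtain I where I: "pre (next_state emp) y I"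
    using base_dm_iff unfolding dm_def by blast
  then obtain m' where "pair m' y \<in>\<^sub>M e" "\<forall>z. z \<in>\<^sub>M I \<longleftrightarrow> (\<exists>k. k \<in>\<^sub>M m' \<and> pair k z \<in>\<^sub>M e)"
    unfolding base_pre_iff base_pre_def by blast
  moreover from this have "m' = m" using y(2) injection_inj[OF injection_e] by blast
  ultimately have "\<forall>u. u \<in>\<^sub>M I \<longrightarrow> \<not> u \<in>\<^sub>M Z" using m(2) maps_pairD[OF maps_e] by blast
  then show "\<exists>x I. x \<in>\<^sub>M Z \<and> pre (next_state emp) x I \<and> (\<forall>u. u \<in>\<^sub>M I \<longrightarrow> \<not> u \<in>\<^sub>M Z)"
    using y(1) I by blast
next
  fix x y z assume "rel (next_state emp) x y z"
  then obtain m n k where *: "code m n k" "pair m x \<in>\<^sub>M e" "pair n y \<in>\<^sub>M e" "pair k z \<in>\<^sub>M e"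
    unfolding base_rel_iff base_rel_def by blast
  have "z \<noteq> a" using *(4) a code_in_omega[OF *(1)] injection_inj[OF injection_e] by blast
  then show "bs (next_state emp) y \<and> bs (next_state emp) z \<and> z \<noteq> a"
    unfolding base_bs_iff using * by blast
next
  fix x assume "bs (next_state emp) x"
  then show "dm (next_state emp) x" unfolding base_bs_iff base_dm_iff .
next
  fix x y assume "bs (next_state emp) x" "bs (next_state emp) y"
  then show "\<exists>z. rel (next_state emp) x y z" unfolding base_bs_iff using base_rel_ex by blast
next
  fix x y x' y' z assume "rel (next_state emp) x y z" "rel (next_state emp) x' y' z"
  then obtain m n k m' n' k' where
    *: "code m n k" "pair m x \<in>\<^sub>M e" "pair n y \<in>\<^sub>M e" "pair k z \<in>\<^sub>M e"
    "code m' n' k'" "pair m' x' \<in>\<^sub>M e" "pair n' y' \<in>\<^sub>M e" "pair k' z \<in>\<^sub>M e"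
    unfolding base_rel_iff base_rel_def by blast
  have "k = k'" using *(4,8) by (rule injection_inj[OF injection_e])
  then have "m = m'" "n = n'" using *(1,5) code_left_unique by blast+
  then show "x = x' \<and> y = y'" using * maps_unique[OF maps_e] by blast
next
  show "bs (next_state emp) a" "bs (next_state emp) b" unfolding base_bs_iff using a b by blast+
qed (simp_all add: base_cod_iff base_dm_iff base_bs_iff)

lemma good_union:
  assumes good: "\<And>\<sigma>. \<sigma> \<in>\<^sub>M C \<Longrightarrow> \<sigma> = emp \<or> good \<sigma>"
    and chain: "\<And>\<sigma> \<tau>. \<sigma> \<in>\<^sub>M C \<Longrightarrow> \<tau> \<in>\<^sub>M C \<Longrightarrow> subset_of \<sigma> \<tau> \<or> subset_of \<tau> \<sigma>"
  shows "union_of C = emp \<or> good (union_of C)"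
proof (cases "union_of C = emp")
  case False
  let ?\<tau> = "union_of C"
  define G where "G \<sigma> \<longleftrightarrow> \<sigma> \<in>\<^sub>M C \<and> good \<sigma>" for \<sigma>
  have G: "\<sigma> \<in>\<^sub>M C \<Longrightarrow> p \<in>\<^sub>M \<sigma> \<Longrightarrow> G \<sigma>" for \<sigma> p using good mem_emp unfolding G_def by metis
  have GC: "\<sigma> \<in>\<^sub>M C" if "G \<sigma>" for \<sigma> using that unfolding G_def by blast
  have GD: "good \<sigma>" if "G \<sigma>" for \<sigma> using that unfolding G_def by blast
  obtain p where "p \<in>\<^sub>M ?\<tau>" using False emp_eqI by blast
  then obtain \<rho> where \<rho>: "G \<rho>" using G unfolding mem_union_of by blast
  have pre: "pre ?\<tau> x I \<longleftrightarrow> (\<exists>\<sigma>. G \<sigma> \<and> pre \<sigma> x I)" for x I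
    using G GC unfolding pre_def mem_union_of by blast
  have rel: "rel ?\<tau> x y z \<longleftrightarrow> (\<exists>\<sigma>. G \<sigma> \<and> rel \<sigma> x y z)" for x y z
    using G GC unfolding rel_def mem_union_of by blast
  have cod: "cod ?\<tau> x t \<longleftrightarrow> (\<exists>\<sigma>. G \<sigma> \<and> cod \<sigma> x t)" for x t
    using G GC unfolding cod_def mem_union_of by blast
  have dm: "dm ?\<tau> x \<longleftrightarrow> (\<exists>\<sigma>. G \<sigma> \<and> dm \<sigma> x)" for x
    unfolding dm_def pre by blast
  have bs: "bs ?\<tau> x \<longleftrightarrow> (\<exists>\<sigma>. G \<sigma> \<and> bs \<sigma> x)" for x
    unfolding bs_def rel by blast
  have common: "\<exists>\<sigma>. G \<sigma> \<and> p \<in>\<^sub>M \<sigma> \<and> q \<in>\<^sub>M \<sigma>" if p: "p \<in>\<^sub>M ?\<tau>" and q: "q \<in>\<^sub>M ?\<tau>" for p q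
  proof -
    obtain \<sigma> where \<sigma>: "\<sigma> \<in>\<^sub>M C" "p \<in>\<^sub>M \<sigma>" using p by auto
    obtain \<rho> where \<rho>: "\<rho> \<in>\<^sub>M C" "q \<in>\<^sub>M \<rho>" using q by auto
    from chain[OF \<sigma>(1) \<rho>(1)] show ?thesis
      using G[OF \<sigma>] G[OF \<rho>] \<sigma>(2) \<rho>(2) unfolding subset_of_def by blast
  qed
  have "good ?\<tau>"
  proof (rule goodI)
    fix x I assume "pre ?\<tau> x I"
    then show "x \<in>\<^sub>M X" unfolding pre using pre_in[OF GD] by blast
  next
    fix x I u assume "pre ?\<tau> x I" "u \<in>\<^sub>M I"
    then show "dm ?\<tau> u" unfolding pre dm using pre_dm[OF GD] by blast
  next
    fix x I J assume "pre ?\<tau> x I" "pre ?\<tau> x J"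
    then obtain \<sigma> where "G \<sigma>" "pre \<sigma> x I" "pre \<sigma> x J" unfolding pre_def using common by blast
    then show "I = J" using pre_unique[OF GD] by blast
  next
    fix x y I J assume "pre ?\<tau> x I" "pre ?\<tau> y J"
    then obtain \<sigma> where "G \<sigma>" "pre \<sigma> x I" "pre \<sigma> y J" unfolding pre_def using common by blast
    then show "x = y \<or> x \<in>\<^sub>M J \<or> y \<in>\<^sub>M I" using pre_linear[OF GD] by blast
  next
    fix Z x assume "x \<in>\<^sub>M Z" "dm ?\<tau> x"
    then obtain \<sigma> where \<sigma>: "G \<sigma>" "dm \<sigma> x" unfolding dm by blast
    show "\<exists>x I. x \<in>\<^sub>M Z \<and> pre ?\<tau> x I \<and> (\<forall>u. u \<in>\<^sub>M I \<longrightarrow> \<not> u \<in>\<^sub>M Z)"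
      using pre_wf[OF GD[OF \<sigma>(1)] \<open>x \<in>\<^sub>M Z\<close> \<sigma>(2)] \<sigma>(1) unfolding pre by blast
  next
    fix x y z assume "rel ?\<tau> x y z"
    then show "bs ?\<tau> y \<and> bs ?\<tau> z \<and> z \<noteq> a" unfolding rel bs using rel_bs[OF GD] by blast
  next
    fix x assume "bs ?\<tau> x"
    then show "dm ?\<tau> x" unfolding bs dm using bs_dm[OF GD] by blast
  next
    fix x y assume "bs ?\<tau> x" "bs ?\<tau> y"
    then obtain \<sigma> where "G \<sigma>" "bs \<sigma> x" "bs \<sigma> y" unfolding bs_def rel_def using common by meson
    then show "\<exists>z. rel ?\<tau> x y z" unfolding rel using ex_rel[OF GD] by blast
  next
    fix x y x' y' z assume "rel ?\<tau> x y z" "rel ?\<tau> x' y' z"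
    then obtain \<sigma> where "G \<sigma>" "rel \<sigma> x y z" "rel \<sigma> x' y' z" unfolding rel_def using common by blast
    then show "x = x' \<and> y = y'" using rel_unique[OF GD] by blast
  next
    show "bs ?\<tau> a" "bs ?\<tau> b" unfolding bs using \<rho> bs_a[OF GD] bs_b[OF GD] by blast+
  next
    fix x t assume "cod ?\<tau> x t"
    then show "dm ?\<tau> x" unfolding cod dm using cod_dm[OF GD] by blast
  next
    fix x t t' assume "cod ?\<tau> x t" "cod ?\<tau> x t'"
    then obtain \<sigma> where "G \<sigma>" "cod \<sigma> x t" "cod \<sigma> x t'" unfolding cod_def using common by blast
    then show "t = t'" using cod_unique[OF GD] by blast
  next
    fix x assume "dm ?\<tau> x" "\<not> bs ?\<tau> x"
    then show "\<exists>t. bs ?\<tau> t \<and> cod ?\<tau> x t" unfolding dm bs cod using ex_cod[OF GD] by blast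
  next
    fix x y t
    assume "\<not> bs ?\<tau> x" "\<not> bs ?\<tau> y" "cod ?\<tau> x t" "cod ?\<tau> y t"
    moreover from this obtain \<sigma> where "G \<sigma>" "cod \<sigma> x t" "cod \<sigma> y t"
      unfolding cod_def using common by blast
    ultimately show "x = y"
      unfolding bs using cod_inj[of \<sigma> x y t] cod_dm[of \<sigma>] GD[of \<sigma>] by blast
  qed
  then show ?thesis ..
qed simp

lemma no_coding: False
proof -
  let ?P = "\<lambda>\<sigma>. subset_of \<sigma> U \<and> (\<sigma> = emp \<or> good \<sigma>)"
  have infl: "subset_of \<sigma> (next_state \<sigma>) \<and> subset_of (next_state \<sigma>) U" if "subset_of \<sigma> U" for \<sigma>
    using that unfolding subset_of_def mem_next_state by blast
  have "\<exists>\<sigma>. ?P \<sigma> \<and> next_state \<sigma> = \<sigma>"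
  proof (rule ex_fixed_point[OF definable_next_state])
    show "definable (\<lambda>v. ?P (v 0))" by (intro df)
    show "?P (next_state \<sigma>)" if "subset_of \<sigma> U" "?P \<sigma>" for \<sigma>
      using infl[OF that(1)] that(2) good_base good_next[OF _ that(1)] by blast
    show "?P (union_of C)"
      if "\<And>\<sigma>. \<sigma> \<in>\<^sub>M C \<Longrightarrow> ?P \<sigma>"
        "\<And>\<sigma> \<tau>. \<sigma> \<in>\<^sub>M C \<Longrightarrow> \<tau> \<in>\<^sub>M C \<Longrightarrow> subset_of \<sigma> \<tau> \<or> subset_of \<tau> \<sigma>" for C
    proof
      show "subset_of (union_of C) U" using that(1) unfolding subset_of_def by auto
      show "union_of C = emp \<or> good (union_of C)" using that by (intro good_union) blast+
    qed
  qed (rule infl)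
  then obtain \<sigma> where \<sigma>: "subset_of \<sigma> U" "\<sigma> = emp \<or> good \<sigma>" "next_state \<sigma> = \<sigma>" by blast
  from \<sigma>(2) show False
  proof
    assume "\<sigma> = emp"
    then show False using good_base good_neq_emp \<sigma>(3) by simp
  next
    assume "good \<sigma>"
    from next_neq[OF this \<sigma>(1)] \<sigma>(3) show False by blast
  qed
qed

end

theorem theorem2:
  fixes E :: "'a \<Rightarrow> 'a \<Rightarrow> bool" and X :: 'a
  assumes "ZF E"
    and "set_structure.lepoll E (set_structure.omega E) X"
  shows "\<not> set_structure.lepoll E (set_structure.pow E X) (set_structure.finseqs E X)"
proof
  interpret ZF E by fact
  assume "lepoll (pow X) (finseqs X)"
  then obtain F where F: "injection F (pow X) (finseqs X)" unfolding lepoll_def by blast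
  obtain e where e: "injection e omega X" using assms(2) unfolding lepoll_def by blast
  then have e_maps: "maps e omega X" by (simp add: injection_def)
  obtain a where a: "E (pair emp a) e"
    using e_maps emp_in_omega unfolding maps_def by blast
  obtain b where b: "E (pair (succ emp) b) e"
    using e_maps succ_in_omega[OF emp_in_omega] unfolding maps_def by blast
  obtain V where V: "\<And>x. E x V \<longleftrightarrow> E x X \<or> E x (pow X)"
    using ex_bin_union[of X "pow X"] by blast
  obtain W where "\<And>x. E x W \<longleftrightarrow> E x omega \<or> E x V" using ex_bin_union[of omega V] by blast
  then have W: "\<And>x. E x W \<longleftrightarrow> E x omega \<or> E x X \<or> E x (pow X)" unfolding V .
  obtain W1 where W1: "\<And>x y. E x W \<Longrightarrow> E y W \<Longrightarrow> E x W1 \<and> E (pair x y) W1"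
    using pair_bound[of W] by blast
  obtain W2 where W2: "\<And>x y. E x W1 \<Longrightarrow> E y W1 \<Longrightarrow> E x W2 \<and> E (pair x y) W2"
    using pair_bound[of W1] by blast
  obtain W3 where W3: "\<And>x y. E x W2 \<Longrightarrow> E y W2 \<Longrightarrow> E x W3 \<and> E (pair x y) W3"
    using pair_bound[of W2] by blast
  have tags: "E emp W" "E (succ emp) W" "E (succ (succ emp)) W" by (simp_all add: W)
  have tag_pair: "E (pair t (pair x y)) W3" if "E t W" "E x W" "E y W1" for t x y
    using W1[OF that(1,1)] W1[OF that(2,2)] W2[of t t] W2[of x y] W3[of t "pair x y"] that(3) by blast
  interpret set_with_coding E X F e a b W3
  proof
    show "E (pair emp (pair x I)) W3" if "E x X" "subset_of I X" for x I
      using that W1[of I I] by (intro tag_pair tags) (auto simp: W mem_pow_iff)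
    show "E (pair (succ emp) (pair x (pair y z))) W3" if "E x X" "E y X" "E z X" for x y z
      using that W1[of y z] by (intro tag_pair tags) (auto simp: W)
    show "E (pair (succ (succ emp)) (pair x t)) W3" if "E x X" "E t X" for x t
      using that W1[of t t] by (intro tag_pair tags) (auto simp: W)
  qed (rule F e a b)+
  show False by (rule no_coding)
qed

end
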